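(* Let $\Bbbk$ be a field. Every affine representable $\Bbbk$-algebra has a coefficient algebra that is a polynomial algebra over $\Bbbk$. That is, if $R$ is an affine representable $\Bbbk$-algebra, then there exist a (commutative) polynomial algebra $P$ over $\Bbbk$, a positive integer $d$, and an injective homomorphism of $\Bbbk$-algebras $R \hookrightarrow \operatorname{Mat}_d(P)$.
   Context: All algebras are associative and unital (not necessarily commutative), over an arbitrary base field $\Bbbk$. A $\Bbbk$-algebra is called affine if it is finitely generated as a $\Bbbk$-algebra. A $\Bbbk$-algebra $R$ is called representable if it embeds (as a $\Bbbk$-algebra) into a matrix algebra $\operatorname{Mat}_d(C)$ over some commutative $\Bbbk$-algebra $C$; any such $C$ is called a coefficient algebra for $R$. *)

theory Defs
  imports "HOL-Library.Poly_Mapping" "Jordan_Normal_Form.Matrix"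
begin

text \<open>
  An associative unital algebra over a field is given by a ring type together with a scalar
  multiplication. The class \<^class>\<open>ring_1\<close> contains the axiom that 0 and 1 are distinct, so the
  zero algebra is excluded.
\<close>

locale k_algebra = vector_space scale
  for scale :: "'k::field \<Rightarrow> 'a::ring_1 \<Rightarrow> 'a" +
  assumes scale_mult_left: "scale c x * y = scale c (x * y)"
    and scale_mult_right: "x * scale c y = scale c (x * y)"

definition subalgebra :: "('k::field \<Rightarrow> 'a::ring_1 \<Rightarrow> 'a) \<Rightarrow> 'a set \<Rightarrow> bool" where
  "subalgebra scale A \<longleftrightarrow>
     1 \<in> A \<and> (\<forall>x\<in>A. \<forall>y\<in>A. x + y \<in> A \<and> x * y \<in> A) \<and> (\<forall>c. \<forall>x\<in>A. scale c x \<in> A)"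

definition affine_algebra :: "('k::field \<Rightarrow> 'a::ring_1 \<Rightarrow> 'a) \<Rightarrow> bool" where
  "affine_algebra scale \<longleftrightarrow>
     k_algebra scale \<and> (\<exists>S. finite S \<and> subalgebra scale hull S = UNIV)"

text \<open>
  Unital algebra homomorphisms from \<open>R\<close> (the whole type) to the \<open>d \<times> d\<close> matrices with entries
  in a subalgebra \<open>C\<close>; scalars act on matrices entrywise.
\<close>

definition mat_algebra_hom ::
  "('k::field \<Rightarrow> 'r::ring_1 \<Rightarrow> 'r) \<Rightarrow> ('k \<Rightarrow> 'c::comm_ring_1 \<Rightarrow> 'c) \<Rightarrow> 'c set \<Rightarrow> nat \<Rightarrow>
   ('r \<Rightarrow> 'c mat) \<Rightarrow> bool" where
  "mat_algebra_hom scale_R scale_C C d \<phi> \<longleftrightarrow>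
     (\<forall>x. \<phi> x \<in> carrier_mat d d \<and> elements_mat (\<phi> x) \<subseteq> C) \<and>
     \<phi> 1 = 1\<^sub>m d \<and>
     (\<forall>x y. \<phi> (x + y) = \<phi> x + \<phi> y) \<and>
     (\<forall>x y. \<phi> (x * y) = \<phi> x * \<phi> y) \<and>
     (\<forall>c x. \<phi> (scale_R c x) = map_mat (scale_C c) (\<phi> x))"

text \<open>
  A commutative algebra is presented as a subalgebra \<open>C\<close> of an ambient commutative algebra
  (possibly all of it).
\<close>

definition coefficient_algebra ::
  "('k::field \<Rightarrow> 'r::ring_1 \<Rightarrow> 'r) \<Rightarrow> ('k \<Rightarrow> 'c::comm_ring_1 \<Rightarrow> 'c) \<Rightarrow> 'c set \<Rightarrow> bool" where
  "coefficient_algebra scale_R scale_C C \<longleftrightarrow>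
     k_algebra scale_C \<and> subalgebra scale_C C \<and>
     (\<exists>d \<phi>. d > 0 \<and> mat_algebra_hom scale_R scale_C C d \<phi> \<and> inj \<phi>)"

text \<open>
  HOL cannot quantify over types inside a formula, so the type \<open>'c\<close> hosting the coefficient
  algebra is a parameter. A theorem that assumes \<open>representable TYPE('c) scale_R\<close> for a type
  variable \<open>'c\<close> covers coefficient algebras of every type.
\<close>

definition representable ::
  "'c::comm_ring_1 itself \<Rightarrow> ('k::field \<Rightarrow> 'r::ring_1 \<Rightarrow> 'r) \<Rightarrow> bool" where
  "representable _ scale_R \<longleftrightarrow>
     (\<exists>(scale_C :: 'k \<Rightarrow> 'c \<Rightarrow> 'c) C. coefficient_algebra scale_R scale_C C)"

text \<open>
  Commutative polynomials are finitely supported maps from monomials to coefficients, a monomial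
  being a finitely supported map from variables (natural numbers) to exponents.
  The set \<open>polynomial_algebra V\<close> is the polynomial algebra on the set of variables \<open>V\<close>.
\<close>

type_synonym 'k polynomial = "(nat \<Rightarrow>\<^sub>0 nat) \<Rightarrow>\<^sub>0 'k"

definition poly_scale :: "'k::field \<Rightarrow> 'k polynomial \<Rightarrow> 'k polynomial" where
  "poly_scale c p = Poly_Mapping.single 0 c * p"

definition polynomial_algebra :: "nat set \<Rightarrow> 'k::field polynomial set" where
  "polynomial_algebra V = {p. \<forall>m \<in> Poly_Mapping.keys p. Poly_Mapping.keys m \<subseteq> V}"

lemma k_algebra_poly_scale: "k_algebra (poly_scale :: 'k::field \<Rightarrow> _)"
  by unfold_locales
    (simp_all add: poly_scale_def algebra_simps single_add mult_single)

lemma subalgebra_polynomial_algebra: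
  "subalgebra poly_scale (polynomial_algebra V :: 'k::field polynomial set)"
proof -
  let ?P = "polynomial_algebra V :: 'k polynomial set"
  have add: "p + q \<in> ?P" if "p \<in> ?P" "q \<in> ?P" for p q
    using that keys_add[of p q] by (auto simp: polynomial_algebra_def)
  have mult: "p * q \<in> ?P" if p: "p \<in> ?P" and q: "q \<in> ?P" for p q
    unfolding polynomial_algebra_def
  proof (intro CollectI ballI)
    fix m assume "m \<in> Poly_Mapping.keys (p * q)"
    then obtain a b where "m = a + b" "a \<in> Poly_Mapping.keys p" "b \<in> Poly_Mapping.keys q"
      using keys_mult[of p q] by blast
    with p q show "Poly_Mapping.keys m \<subseteq> V"
      using keys_add[of a b] unfolding polynomial_algebra_def by blast
  qed
  have const: "Poly_Mapping.single 0 c \<in> ?P" for c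
    by (auto simp: polynomial_algebra_def)
  then show ?thesis
    using add mult const[of 1] by (auto simp: subalgebra_def poly_scale_def)
qed

end

theory Submission
  imports Defs "Jordan_Normal_Form.Char_Poly" "HOL-Computational_Algebra.Polynomial_Factorial"
begin

text \<open>
  Let \<open>P\<close> be the polynomial ring in countably many variables. Since the algebra \<open>R\<close> is generated by
  finitely many elements, only finitely many entries of the matrices that represent it matter, so the
  coefficients may be taken in a quotient of \<open>P\<close> by an ideal \<open>I\<close> that contains almost all
  variables. If \<open>I\<close> is the exact kernel of a homomorphism from \<open>P\<close> to matrices over \<open>P\<close>, each
  entry can be replaced by a matrix over \<open>P\<close>, which embeds \<open>R\<close> in a larger matrix algebra over \<open>P\<close>
  (\<open>matrix_rep_compose\<close>). So everything rests on \<open>ideal_representation\<close>: every such \<open>I\<close> is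
  the kernel of a matrix representation of \<open>P\<close> over \<open>P\<close>.

  Block sums deal with intersections of ideals. By the ascending chain condition
  (\<open>ascending_chain_condition\<close>) it is therefore enough to treat irreducible ideals, and these
  are primary (\<open>primary_if_irreducible\<close>). Modulo a primary ideal take a maximal set of
  algebraically independent variables. The nonzero polynomials in them are not zero divisors, and over
  their field of fractions the quotient becomes a finite-dimensional algebra. Its regular
  representation has entries in the field of fractions of \<open>P\<close> (\<open>primary_representation\<close>).

  It remains to get rid of denominators. A change of basis need not help, as there is
  no evident free module of full rank over the polynomial ring that the quotient preserves. Instead,
  invert a common denominator \<open>h\<close>. The localization at \<open>h\<close> is the coordinate ring of the hypersurface
  \<open>h t = 1\<close>, and a change of variables makes this equation monic in \<open>t\<close>, so the localization is free of
  finite rank over another polynomial ring (\<open>localization_representation\<close>). Replacing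
  entries by matrices once more finishes the proof.
\<close>

section \<open>Polynomials and their evaluation\<close>

abbreviation pconst :: "'k::field \<Rightarrow> 'k polynomial" where
  "pconst c \<equiv> Poly_Mapping.single 0 c"

definition pvar :: "nat \<Rightarrow> 'k::field polynomial" where
  "pvar i = Poly_Mapping.single (Poly_Mapping.single i 1) 1"

text \<open>
  Taking values in an arbitrary commutative monoid lets one function serve for the values of
  monomials and, with \<open>pvar\<close> for \<open>g\<close>, for the monomials themselves as polynomials.
\<close>

definition monomial_value :: "(nat \<Rightarrow> 'b::comm_monoid_mult) \<Rightarrow> (nat \<Rightarrow>\<^sub>0 nat) \<Rightarrow> 'b" where
  "monomial_value g m = (\<Prod>i\<in>Poly_Mapping.keys m. g i ^ Poly_Mapping.lookup m i)"

text \<open>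
  The homomorphism given by the universal property of polynomial rings: \<open>e\<close> embeds the scalars
  and \<open>g\<close> gives the images of the variables.
\<close>

definition eval_polynomial ::
  "('k::field \<Rightarrow> 'b::comm_ring_1) \<Rightarrow> (nat \<Rightarrow> 'b) \<Rightarrow> 'k polynomial \<Rightarrow> 'b" where
  "eval_polynomial e g p =
     (\<Sum>m\<in>Poly_Mapping.keys p. e (Poly_Mapping.lookup p m) * monomial_value g m)"

lemma pconst_eq_0_iff [simp]: "pconst c = 0 \<longleftrightarrow> c = 0"
  by (metis lookup_single_eq lookup_zero single_zero)

lemma sum_singles: "(\<Sum>m\<in>Poly_Mapping.keys p. Poly_Mapping.single m (Poly_Mapping.lookup p m)) = p"
  by (rule poly_mapping_eqI)
    (auto simp: lookup_sum lookup_single when_def in_keys_iff)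

lemma monomial_value_superset:
  assumes "finite A" "Poly_Mapping.keys m \<subseteq> A"
  shows "monomial_value g m = (\<Prod>i\<in>A. g i ^ Poly_Mapping.lookup m i)"
  unfolding monomial_value_def
  by (rule prod.mono_neutral_left) (use assms in \<open>auto simp: in_keys_iff\<close>)

lemma monomial_value_0 [simp]: "monomial_value g 0 = 1"
  by (simp add: monomial_value_def)

lemma monomial_value_single [simp]: "monomial_value g (Poly_Mapping.single i n) = g i ^ n"
  by (cases "n = 0") (simp_all add: monomial_value_def)

lemma monomial_value_add:
  "monomial_value g (m + m') = monomial_value g m * monomial_value g m'"
proof -
  let ?A = "Poly_Mapping.keys m \<union> Poly_Mapping.keys m'"
  have "Poly_Mapping.keys (m + m') \<subseteq> ?A" by (rule keys_add)
  then show ?thesis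
    by (simp add: monomial_value_superset[of ?A] lookup_add power_add prod.distrib)
qed

lemma single_eq_monomial_value:
  "Poly_Mapping.single m (1::'k::field) = monomial_value pvar m"
proof -
  have pow: "Poly_Mapping.single (Poly_Mapping.single i n) (1::'k) = pvar i ^ n" for i n
  proof (induction n)
    case (Suc n)
    have "pvar i ^ Suc n = pvar i * Poly_Mapping.single (Poly_Mapping.single i n) (1::'k)"
      using Suc by simp
    also have "\<dots> = Poly_Mapping.single (Poly_Mapping.single i (Suc n)) 1"
      by (simp add: pvar_def mult_single flip: single_add)
    finally show ?case ..
  qed simp
  have "Poly_Mapping.single (\<Sum>i\<in>A. Poly_Mapping.single i (f i)) (1::'k) =
      (\<Prod>i\<in>A. pvar i ^ f i)" if "finite A" for A and f :: "nat \<Rightarrow> nat"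
    using that
  proof (induction A rule: finite_induct)
    case (insert a A)
    have "Poly_Mapping.single (\<Sum>i\<in>insert a A. Poly_Mapping.single i (f i)) (1::'k) =
        Poly_Mapping.single (Poly_Mapping.single a (f a)) 1 *
        Poly_Mapping.single (\<Sum>i\<in>A. Poly_Mapping.single i (f i)) 1"
      using insert(1,2) by (simp add: mult_single)
    with insert show ?case by (simp add: pow)
  qed simp
  from this[of "Poly_Mapping.keys m" "Poly_Mapping.lookup m"] show ?thesis
    by (simp add: sum_singles monomial_value_def)
qed

lemma single_eq_const_times:
  "Poly_Mapping.single m c = pconst c * monomial_value pvar m" for c :: "'k::field"
  unfolding single_eq_monomial_value[symmetric] by (simp add: mult_single)

text \<open>
  A polynomial algebra is generated by the constants and its variables. Most facts about
  polynomials below are closure properties proved by this induction.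
\<close>

lemma polynomial_algebra_induct [consumes 1, case_names const add mult var]:
  assumes p: "p \<in> polynomial_algebra V"
    and const: "\<And>c. Q (pconst c)"
    and add: "\<And>p q. Q p \<Longrightarrow> Q q \<Longrightarrow> Q (p + q)"
    and mult: "\<And>p q. Q p \<Longrightarrow> Q q \<Longrightarrow> Q (p * q)"
    and var: "\<And>i. i \<in> V \<Longrightarrow> Q (pvar i)"
  shows "Q p"
proof -
  have one: "Q 1" using const[of 1] by simp
  have pow: "Q (q ^ n)" if "Q q" for q n
    by (induction n) (use one mult that in auto)
  have prod: "Q (\<Prod>i\<in>A. f i)" if "\<And>i. i \<in> A \<Longrightarrow> Q (f i)" for A :: "nat set" and f
    using that by (induction A rule: infinite_finite_induct) (auto intro: one mult)
  have mon: "Q (monomial_value pvar m)" if "Poly_Mapping.keys m \<subseteq> V" for m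
    unfolding monomial_value_def using that by (intro prod pow var) auto
  have sum: "Q (\<Sum>m\<in>A. f m)" if "\<And>m. m \<in> A \<Longrightarrow> Q (f m)" for A :: "(nat \<Rightarrow>\<^sub>0 nat) set" and f
    using that by (induction A rule: infinite_finite_induct) (use const[of 0] in \<open>auto intro: add\<close>)
  have "Q (\<Sum>m\<in>Poly_Mapping.keys p. Poly_Mapping.single m (Poly_Mapping.lookup p m))"
  proof (rule sum)
    fix m assume "m \<in> Poly_Mapping.keys p"
    with p have "Poly_Mapping.keys m \<subseteq> V" by (auto simp: polynomial_algebra_def)
    then show "Q (Poly_Mapping.single m (Poly_Mapping.lookup p m))"
      by (subst single_eq_const_times) (intro mult const mon)
  qed
  then show ?thesis by (simp add: sum_singles)
qed

lemma polynomial_algebra_UNIV [simp]: "polynomial_algebra UNIV = UNIV"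
  by (simp add: polynomial_algebra_def)

lemmas polynomial_induct [case_names const add mult var] =
  polynomial_algebra_induct[where V = UNIV, simplified]

lemma pconst_in_polynomial_algebra [simp]: "pconst c \<in> polynomial_algebra V"
  by (auto simp: polynomial_algebra_def)

lemma pvar_in_polynomial_algebra [simp]: "pvar i \<in> polynomial_algebra V \<longleftrightarrow> i \<in> V"
  by (auto simp: polynomial_algebra_def pvar_def)

lemma polynomial_algebra_closed:
  shows polynomial_algebra_0 [simp]: "0 \<in> polynomial_algebra V"
    and polynomial_algebra_1 [simp]: "1 \<in> polynomial_algebra V"
    and polynomial_algebra_add: "\<lbrakk>p \<in> polynomial_algebra V; q \<in> polynomial_algebra V\<rbrakk> \<Longrightarrow>
      p + q \<in> polynomial_algebra V"
    and polynomial_algebra_mult: "\<lbrakk>p \<in> polynomial_algebra V; q \<in> polynomial_algebra V\<rbrakk> \<Longrightarrow>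
      p * q \<in> polynomial_algebra V"
  using subalgebra_polynomial_algebra[of V] pconst_in_polynomial_algebra[of 0 V]
  by (auto simp: subalgebra_def)

lemma polynomial_algebra_uminus:
  "p \<in> polynomial_algebra V \<Longrightarrow> - p \<in> polynomial_algebra V"
  using polynomial_algebra_mult[OF pconst_in_polynomial_algebra[of "-1" V], of p]
  by (simp add: single_uminus)

lemma polynomial_algebra_empty_const:
  assumes "p \<in> polynomial_algebra {}" obtains c where "p = pconst c"
proof -
  have "\<exists>c. p = pconst c"
    using assms
  proof (induction rule: polynomial_algebra_induct)
    case (add p q)
    then obtain a b where "p = pconst a" "q = pconst b" by blast
    then have "p + q = pconst (a + b)" by (simp add: single_add)
    then show ?case ..
  next
    case (mult p q)
    then obtain a b where "p = pconst a" "q = pconst b" by blast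
    then have "p * q = pconst (a * b)" by (simp add: mult_single)
    then show ?case ..
  qed auto
  then show ?thesis using that by blast
qed

lemma eval_polynomial_hom:
  fixes e :: "'k::field \<Rightarrow> 'b::comm_ring_1"
  assumes e: "comm_ring_hom e"
  shows "comm_ring_hom (eval_polynomial e g)"
    and eval_polynomial_const: "eval_polynomial e g (pconst c) = e c"
    and eval_polynomial_var: "eval_polynomial e g (pvar i) = g i"
proof -
  interpret e: comm_ring_hom e by fact
  let ?v = "eval_polynomial e g"
  have single: "?v (Poly_Mapping.single m c) = e c * monomial_value g m" for m c
    by (cases "c = 0") (simp_all add: eval_polynomial_def)
  show c: "?v (pconst c) = e c" for c by (simp add: single)
  show "?v (pvar i) = g i" by (simp add: pvar_def single)
  have superset: "?v p = (\<Sum>m\<in>A. e (Poly_Mapping.lookup p m) * monomial_value g m)"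
    if "finite A" "Poly_Mapping.keys p \<subseteq> A" for A p
    unfolding eval_polynomial_def
    by (rule sum.mono_neutral_left) (use that in \<open>auto simp: in_keys_iff\<close>)
  have add: "?v (p + q) = ?v p + ?v q" for p q
    using keys_add[of p q]
    by (simp add: superset[of "Poly_Mapping.keys p \<union> Poly_Mapping.keys q"] lookup_add
        e.hom_add distrib_right sum.distrib)
  have zero: "?v 0 = 0" by (simp add: eval_polynomial_def)
  have sum: "?v (\<Sum>a\<in>A. f a) = (\<Sum>a\<in>A. ?v (f a))" for A :: "(nat \<Rightarrow>\<^sub>0 nat) set" and f
    by (induction A rule: infinite_finite_induct) (auto simp: zero add)
  have mult: "?v (p * q) = ?v p * ?v q" for p q
  proof -
    let ?s = "\<lambda>p m. Poly_Mapping.single m (Poly_Mapping.lookup p m)"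
    have "p * q = (\<Sum>m\<in>Poly_Mapping.keys p. ?s p m) * (\<Sum>m\<in>Poly_Mapping.keys q. ?s q m)"
      by (simp only: sum_singles)
    also have "\<dots> = (\<Sum>m\<in>Poly_Mapping.keys p. \<Sum>m'\<in>Poly_Mapping.keys q. ?s p m * ?s q m')"
      by (rule sum_product)
    finally have "?v (p * q) = ?v (\<Sum>m\<in>Poly_Mapping.keys p. \<Sum>m'\<in>Poly_Mapping.keys q. ?s p m * ?s q m')"
      by (rule arg_cong)
    also have "\<dots> = (\<Sum>m\<in>Poly_Mapping.keys p. \<Sum>m'\<in>Poly_Mapping.keys q. ?v (?s p m * ?s q m'))"
      by (simp only: sum)
    also have "\<dots> = (\<Sum>m\<in>Poly_Mapping.keys p. \<Sum>m'\<in>Poly_Mapping.keys q. ?v (?s p m) * ?v (?s q m'))"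
      by (simp add: mult_single single e.hom_mult monomial_value_add mult_ac)
    also have "\<dots> = (\<Sum>m\<in>Poly_Mapping.keys p. ?v (?s p m)) * (\<Sum>m\<in>Poly_Mapping.keys q. ?v (?s q m))"
      by (rule sum_product[symmetric])
    also have "\<dots> = ?v p * ?v q"
      using sum[of "?s p" "Poly_Mapping.keys p"] sum[of "?s q" "Poly_Mapping.keys q"]
      by (simp only: sum_singles)
    finally show ?thesis .
  qed
  show "comm_ring_hom ?v"
    using add mult zero c[of 1] by unfold_locales auto
qed

section \<open>Matrix representations as families of entry functions\<close>

text \<open>
  A homomorphism to \<open>d \<times> d\<close> matrices is handled as a family of entry functions. Two things
  become easier than with a matrix type: the entries of a product are plain finite sums, and
  entries can be moved between coefficient rings one by one.
\<close>

definition matrix_rep ::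
  "('k \<Rightarrow> 'x::ring_1 \<Rightarrow> 'x) \<Rightarrow> ('k \<Rightarrow> 'c::comm_ring_1 \<Rightarrow> 'c) \<Rightarrow> nat \<Rightarrow>
   (nat \<Rightarrow> nat \<Rightarrow> 'x \<Rightarrow> 'c) \<Rightarrow> bool" where
  "matrix_rep scX scC d f \<longleftrightarrow> (\<forall>i<d. \<forall>j<d.
     f i j 1 = (if i = j then 1 else 0) \<and>
     (\<forall>x y. f i j (x + y) = f i j x + f i j y) \<and>
     (\<forall>x y. f i j (x * y) = (\<Sum>k<d. f i k x * f k j y)) \<and>
     (\<forall>c x. f i j (scX c x) = scC c (f i j x)))"

text \<open>
  Prescribing the kernel of a representation of a polynomial ring is a way to speak of faithful
  representations of its quotients, for which there are no types.
\<close>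

definition rep_kernel :: "nat \<Rightarrow> (nat \<Rightarrow> nat \<Rightarrow> 'x \<Rightarrow> 'c::zero) \<Rightarrow> 'x set" where
  "rep_kernel d f = {x. \<forall>i<d. \<forall>j<d. f i j x = 0}"

lemma matrix_rep_of_hom:
  assumes "mat_algebra_hom scX scC C d \<phi>"
  shows "matrix_rep scX scC d (\<lambda>i j x. \<phi> x $$ (i, j))"
proof -
  have c: "\<phi> x \<in> carrier_mat d d" for x using assms by (auto simp: mat_algebra_hom_def)
  note d = carrier_matD[OF c]
  show ?thesis
    using assms d unfolding matrix_rep_def mat_algebra_hom_def
    by (auto simp: scalar_prod_def lessThan_atLeast0)
qed

lemma hom_of_matrix_rep:
  assumes "matrix_rep scX scC d f"
  shows "mat_algebra_hom scX scC UNIV d (\<lambda>x. mat d d (\<lambda>(i, j). f i j x))"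
  using assms unfolding matrix_rep_def mat_algebra_hom_def
  by (auto intro!: eq_matI simp: scalar_prod_def lessThan_atLeast0)

lemma matrix_rep_simps:
  assumes "matrix_rep scX scC d f" "i < d" "j < d"
  shows "f i j 1 = (if i = j then 1 else 0)" "f i j (x + y) = f i j x + f i j y"
    "f i j (x * y) = (\<Sum>k<d. f i k x * f k j y)" "f i j (scX c x) = scC c (f i j x)"
    "f i j 0 = 0" "f i j (x - y) = f i j x - f i j y"
proof -
  have add: "f i j (x + y) = f i j x + f i j y" for x y using assms by (auto simp: matrix_rep_def)
  show "f i j 1 = (if i = j then 1 else 0)"  "f i j (x * y) = (\<Sum>k<d. f i k x * f k j y)"
     "f i j (scX c x) = scC c (f i j x)" using assms by (auto simp: matrix_rep_def)
  show "f i j (x + y) = f i j x + f i j y" by (rule add)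
  show "f i j 0 = 0" using add[of 0 0] by simp
  show "f i j (x - y) = f i j x - f i j y" using add[of "x - y" y] by (simp add: algebra_simps)
qed

lemma sum_div_mod:
  fixes F :: "nat \<Rightarrow> nat \<Rightarrow> 'a::comm_monoid_add"
  shows "(\<Sum>k<d * e. F (k div e) (k mod e)) = (\<Sum>a<d. \<Sum>b<e. F a b)"
proof -
  have "(\<Sum>k<d * e. F (k div e) (k mod e)) = (\<Sum>a<d. \<Sum>k=a*e..<a*e+e. F (k div e) (k mod e))"
    by (rule sum.nat_group[symmetric])
  also have "\<dots> = (\<Sum>a<d. \<Sum>b<e. F a b)"
  proof (rule sum.cong[OF refl])
    fix a
    have "(\<Sum>k=a*e..<a*e+e. F (k div e) (k mod e)) = (\<Sum>b=0..<e. F ((b + a*e) div e) ((b + a*e) mod e))"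
      using sum.shift_bounds_nat_ivl[of "\<lambda>k. F (k div e) (k mod e)" 0 "a*e" e] by (simp add: add.commute)
    also have "\<dots> = (\<Sum>b<e. F a b)" by (intro sum.cong) auto
    finally show "(\<Sum>k=a*e..<a*e+e. F (k div e) (k mod e)) = (\<Sum>b<e. F a b)" .
  qed
  finally show ?thesis .
qed

text \<open>
  Matrices of matrices are matrices: if the coefficients come from a quotient of a ring \<open>X\<close>, and
  \<open>X\<close> has a matrix representation \<open>h\<close> with the same kernel as the quotient map \<open>\<pi>\<close>, then every
  coefficient can be replaced by the \<open>h\<close>-matrix of a preimage. Equality of the two kernels
  makes this both well defined and injective, so the overall kernel does not change.
\<close>

lemma matrix_rep_compose:
  fixes \<pi> :: "'x::comm_ring_1 \<Rightarrow> 'c::comm_ring_1"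
  assumes f: "matrix_rep scR scC d f"
    and entries: "\<And>i j r. i < d \<Longrightarrow> j < d \<Longrightarrow> f i j r \<in> range \<pi>"
    and \<pi>: "comm_ring_hom \<pi>" and \<pi>_scale: "\<And>c x. \<pi> (scX c x) = scC c (\<pi> x)"
    and h: "matrix_rep scX scE e h" and ker: "rep_kernel e h = {x. \<pi> x = 0}"
  shows "\<exists>d' f'. matrix_rep scR scE d' f' \<and> rep_kernel d' f' = rep_kernel d f"
proof -
  interpret \<pi>: comm_ring_hom \<pi> by fact
  \<comment> \<open>The choice of a preimage does not matter, by the equality of kernels.\<close>
  define lift where "lift y = (SOME x. \<pi> x = y)" for y
  have lift: "\<pi> (lift y) = y" if "y \<in> range \<pi>" for y
    unfolding lift_def using that by (metis (mono_tags) rangeE someI)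
  define h' where "h' i j y = h i j (lift y)" for i j y
  have h': "h' i j (\<pi> x) = h i j x" if "i < e" "j < e" for i j x
  proof -
    have "lift (\<pi> x) - x \<in> rep_kernel e h" unfolding ker by (simp add: lift \<pi>.hom_minus)
    then show ?thesis using that matrix_rep_simps(6)[OF h] by (simp add: rep_kernel_def h'_def)
  qed
  have h'_add: "h' i j (y + z) = h' i j y + h' i j z"
    if "i < e" "j < e" "y \<in> range \<pi>" "z \<in> range \<pi>" for i j y z
    using that h' matrix_rep_simps(2)[OF h] by (auto simp flip: \<pi>.hom_add)
  have h'_mult: "h' i j (y * z) = (\<Sum>k<e. h' i k y * h' k j z)"
    if "i < e" "j < e" "y \<in> range \<pi>" "z \<in> range \<pi>" for i j y z
    using that h' matrix_rep_simps(3)[OF h] by (auto simp flip: \<pi>.hom_mult)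
  have h'_scale: "h' i j (scC c y) = scE c (h' i j y)"
    if "i < e" "j < e" "y \<in> range \<pi>" for i j y c
    using that h' matrix_rep_simps(4)[OF h] by (auto simp flip: \<pi>_scale)
  have h'_1: "h' i j 1 = (if i = j then 1 else 0)" if "i < e" "j < e" for i j
    using h'[OF that, of 1] matrix_rep_simps(1)[OF h that] by simp
  have h'_0: "h' i j 0 = 0" if "i < e" "j < e" for i j
    using h'[OF that, of 0] matrix_rep_simps(5)[OF h that] by simp
  have h'_sum: "h' i j (\<Sum>k\<in>A. F k) = (\<Sum>k\<in>A. h' i j (F k))"
    if "i < e" "j < e" "\<And>k. k \<in> A \<Longrightarrow> F k \<in> range \<pi>" for i j F and A :: "nat set"
    using that(3)
  proof (induction A rule: infinite_finite_induct)
    case (insert a A)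
    then have "(\<Sum>k\<in>A. F k) = \<pi> (\<Sum>k\<in>A. lift (F k))" by (simp add: \<pi>.hom_sum lift)
    then have "(\<Sum>k\<in>A. F k) \<in> range \<pi>" by simp
    with insert that show ?case by (simp add: h'_add)
  qed (use that h'_0 in auto)
  define f' where "f' i j r = h' (i mod e) (j mod e) (f (i div e) (j div e) r)" for i j r
  have bounds: "i div e < d \<and> i mod e < e" if "i < d * e" for i
    using that by (metis less_mult_imp_div_less mod_less_divisor mult_0_right not_less0 gr0I)
  have eq: "i = j \<longleftrightarrow> i div e = j div e \<and> i mod e = j mod e" for i j :: nat
    by (metis div_mult_mod_eq)
  have "matrix_rep scR scE (d * e) f'"
    unfolding matrix_rep_def
  proof (intro allI impI conjI)
    fix i j assume i: "i < d * e" and j: "j < d * e"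
    note b = bounds[OF i] bounds[OF j]
    show "f' i j 1 = (if i = j then 1 else 0)"
      using b by (auto simp: f'_def matrix_rep_simps(1)[OF f] h'_1 h'_0 eq[of i j])
    show "f' i j (x + y) = f' i j x + f' i j y" for x y
      using b by (simp add: f'_def matrix_rep_simps(2)[OF f] h'_add entries)
    show "f' i j (scR c x) = scE c (f' i j x)" for c x
      using b by (simp add: f'_def matrix_rep_simps(4)[OF f] h'_scale entries)
    show "f' i j (x * y) = (\<Sum>k<d * e. f' i k x * f' k j y)" for x y
    proof -
      have prod: "f a k x * f k c y \<in> range \<pi>" if "a < d" "k < d" "c < d" for a k c
      proof -
        from entries[OF that(1,2), of x] entries[OF that(2,3), of y]
        obtain p q where "f a k x = \<pi> p" "f k c y = \<pi> q" by blast
        then have "f a k x * f k c y = \<pi> (p * q)" by (simp add: \<pi>.hom_mult)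
        then show ?thesis by simp
      qed
      have "f' i j (x * y) = (\<Sum>a<d. h' (i mod e) (j mod e) (f (i div e) a x * f a (j div e) y))"
        unfolding f'_def
        using b by (subst matrix_rep_simps(3)[OF f], simp, simp, subst h'_sum) (auto intro: prod)
      also have "\<dots> = (\<Sum>a<d. \<Sum>b<e. h' (i mod e) b (f (i div e) a x) * h' b (j mod e) (f a (j div e) y))"
        using b by (intro sum.cong refl) (simp add: h'_mult entries)
      also have "\<dots> = (\<Sum>k<d * e. f' i k x * f' k j y)"
        unfolding f'_def by (rule sum_div_mod[symmetric])
      finally show ?thesis .
    qed
  qed
  moreover have "rep_kernel (d * e) f' = rep_kernel d f"
  proof -
    have zero: "y = 0 \<longleftrightarrow> (\<forall>a<e. \<forall>b<e. h' a b y = 0)" if "y \<in> range \<pi>" for y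
    proof -
      from that obtain x where y: "y = \<pi> x" by blast
      have "\<pi> x = 0 \<longleftrightarrow> x \<in> rep_kernel e h" by (simp add: ker)
      then show ?thesis unfolding y rep_kernel_def by (simp add: h')
    qed
    have "(\<forall>i<d * e. \<forall>j<d * e. f' i j r = 0) \<longleftrightarrow>
        (\<forall>a<d. \<forall>c<d. \<forall>i<e. \<forall>j<e. h' i j (f a c r) = 0)" for r
    proof (intro iffI allI impI)
      fix a c i j assume *: "\<forall>i<d * e. \<forall>j<d * e. f' i j r = 0" "a < d" "c < d" "i < e" "j < e"
      have lt: "a * e + i < d * e" if "a < d" "i < e" for a i
      proof -
        have "a * e + i < (a + 1) * e" using that by simp
        also have "\<dots> \<le> d * e" using that by (intro mult_right_mono) auto
        finally show ?thesis .
      qed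
      have "f' (a * e + i) (c * e + j) r = 0" using * lt by blast
      then show "h' i j (f a c r) = 0" using * by (simp add: f'_def)
    qed (use bounds in \<open>auto simp: f'_def\<close>)
    then show ?thesis unfolding rep_kernel_def using zero entries by auto
  qed
  ultimately show ?thesis by blast
qed

text \<open>
  Block diagonal matrices turn an intersection of two kernels into a kernel.
\<close>

lemma matrix_rep_block_sum:
  fixes scC :: "'k \<Rightarrow> 'c::comm_ring_1 \<Rightarrow> 'c"
  assumes f: "matrix_rep scX scC d f" and g: "matrix_rep scX scC e g"
    and scC: "\<And>c. scC c 0 = 0"
  shows "\<exists>d' h. matrix_rep scX scC d' h \<and> rep_kernel d' h = rep_kernel d f \<inter> rep_kernel e g"
proof -
  define h where "h i j x = (if i < d \<and> j < d then f i j x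
    else if \<not> i < d \<and> \<not> j < d then g (i - d) (j - d) x else 0)" for i j x
  have split: "(\<Sum>k<d + e. F k) = (\<Sum>k<d. F k) + (\<Sum>k<e. F (d + k))" for F :: "nat \<Rightarrow> 'c"
    by (induction e) (simp_all add: algebra_simps)
  have "matrix_rep scX scC (d + e) h"
    unfolding matrix_rep_def
  proof (intro allI impI conjI)
    fix i j assume i: "i < d + e" and j: "j < d + e"
    have b: "i - d < e" if "\<not> i < d" using i that by auto
    have b': "j - d < e" if "\<not> j < d" using j that by auto
    show "h i j 1 = (if i = j then 1 else 0)" 
      using b b' by (auto simp: h_def matrix_rep_simps(1)[OF f] matrix_rep_simps(1)[OF g])
    show "h i j (x + y) = h i j x + h i j y" for x y
      using b b' by (auto simp: h_def matrix_rep_simps(2)[OF f] matrix_rep_simps(2)[OF g])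
    show "h i j (scX c x) = scC c (h i j x)" for c x
      using b b' by (auto simp: h_def matrix_rep_simps(4)[OF f] matrix_rep_simps(4)[OF g] scC)
    show "h i j (x * y) = (\<Sum>k<d + e. h i k x * h k j y)" for x y
      using b b' by (auto simp: h_def split matrix_rep_simps(3)[OF f] matrix_rep_simps(3)[OF g])
  qed
  moreover have "rep_kernel (d + e) h = rep_kernel d f \<inter> rep_kernel e g"
  proof -
    have "(\<forall>i<d + e. \<forall>j<d + e. h i j x = 0) \<longleftrightarrow>
      (\<forall>i<d. \<forall>j<d. f i j x = 0) \<and> (\<forall>i<e. \<forall>j<e. g i j x = 0)" for x
    proof (intro iffI conjI allI impI)
      fix i j assume *: "\<forall>i<d + e. \<forall>j<d + e. h i j x = 0" "i < e" "j < e"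
      then have "h (d + i) (d + j) x = 0" by simp
      then show "g i j x = 0" by (simp add: h_def)
    next
      fix i j assume *: "\<forall>i<d + e. \<forall>j<d + e. h i j x = 0" "i < d" "j < d"
      then have "h i j x = 0" by simp
      then show "f i j x = 0" using * by (simp add: h_def)
    next
      fix i j
      assume "(\<forall>i<d. \<forall>j<d. f i j x = 0) \<and> (\<forall>i<e. \<forall>j<e. g i j x = 0)" "i < d + e" "j < d + e"
      then show "h i j x = 0" by (auto simp: h_def)
    qed
    then show ?thesis by (auto simp: rep_kernel_def)
  qed
  ultimately show ?thesis by blast
qed

text \<open>
  The regular representation. If a commutative algebra is free of finite rank over a subring,
  multiplication operators in a basis give a faithful matrix representation over that subring.
  The algebra here is a quotient by \<open>I\<close> of a subring of \<open>'b\<close>, and the scalars are the image of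
  \<open>D\<close> under \<open>\<sigma>\<close>, so freeness is stated as existence and uniqueness of coordinates modulo \<open>I\<close>.
  The algebra is only seen through \<open>g\<close>, so the kernel is the inverse image of \<open>I\<close>: an element
  that kills the basis modulo \<open>I\<close> also kills 1.
\<close>

lemma regular_representation:
  fixes g :: "'x::comm_ring_1 \<Rightarrow> 'b::comm_ring_1" and \<sigma> :: "'c::comm_ring_1 \<Rightarrow> 'b"
    and b :: "nat \<Rightarrow> 'b"
  assumes g: "comm_ring_hom g" and \<sigma>: "comm_ring_hom \<sigma>"
    and I_add: "\<And>y z. y \<in> I \<Longrightarrow> z \<in> I \<Longrightarrow> y + z \<in> I" and I_0: "0 \<in> I"
    and I_g: "\<And>x y. y \<in> I \<Longrightarrow> g x * y \<in> I"
    and I_b: "\<And>i y. i < m \<Longrightarrow> y \<in> I \<Longrightarrow> y * b i \<in> I"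
    and I_D: "\<And>a y. a \<in> D \<Longrightarrow> y \<in> I \<Longrightarrow> \<sigma> a * y \<in> I"
    and D_add: "\<And>a a'. a \<in> D \<Longrightarrow> a' \<in> D \<Longrightarrow> a + a' \<in> D"
    and D_mult: "\<And>a a'. a \<in> D \<Longrightarrow> a' \<in> D \<Longrightarrow> a * a' \<in> D"
    and D_0: "0 \<in> D" and D_1: "1 \<in> D" and D_minus: "\<And>a. a \<in> D \<Longrightarrow> - a \<in> D"
    and kD: "\<And>c. \<kappa> c \<in> D" and scX: "\<And>c x. g (scX c x) = \<sigma> (\<kappa> c) * g x"
    and scC: "\<And>c a. scC c a = \<kappa> c * a"
    and span: "\<And>x i. i < m \<Longrightarrow> \<exists>a. (\<forall>j<m. a j \<in> D) \<and> g x * b i - (\<Sum>j<m. \<sigma> (a j) * b j) \<in> I"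
    and one: "\<exists>a. (\<forall>j<m. a j \<in> D) \<and> 1 - (\<Sum>j<m. \<sigma> (a j) * b j) \<in> I"
    and indep: "\<And>a j. (\<forall>j<m. a j \<in> D) \<Longrightarrow> (\<Sum>j<m. \<sigma> (a j) * b j) \<in> I \<Longrightarrow> j < m \<Longrightarrow> a j = 0"
  shows "\<exists>f. matrix_rep scX scC m f \<and> rep_kernel m f = {x. g x \<in> I}"
proof -
  interpret g: comm_ring_hom g by fact
  interpret \<sigma>: comm_ring_hom \<sigma> by fact
  have I_minus: "- y \<in> I" if "y \<in> I" for y using I_g[OF that, of "-1"] by (simp add: g.hom_uminus)
  have I_diff: "y - z \<in> I" if "y \<in> I" "z \<in> I" for y z
    using I_add[OF that(1) I_minus[OF that(2)]] by simp
  have I_sum: "(\<Sum>k\<in>A. F k) \<in> I" if "\<And>k. k \<in> A \<Longrightarrow> F k \<in> I" for F and A :: "nat set"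
    using that by (induction A rule: infinite_finite_induct) (auto intro: I_add I_0)
  have D_sum: "(\<Sum>k\<in>A. F k) \<in> D" if "\<And>k. k \<in> A \<Longrightarrow> F k \<in> D" for F and A :: "nat set"
    using that by (induction A rule: infinite_finite_induct) (auto intro: D_add D_0)
  obtain f where fD: "\<And>i j x. i < m \<Longrightarrow> j < m \<Longrightarrow> f i j x \<in> D"
    and f: "\<And>i x. i < m \<Longrightarrow> g x * b i - (\<Sum>j<m. \<sigma> (f i j x) * b j) \<in> I"
  proof -
    have "\<forall>i x. \<exists>a. i < m \<longrightarrow> (\<forall>j<m. a j \<in> D) \<and> g x * b i - (\<Sum>j<m. \<sigma> (a j) * b j) \<in> I"
      using span by blast
    then obtain F where F: "\<forall>i x. i < m \<longrightarrow> (\<forall>j<m. F i x j \<in> D) \<and> g x * b i - (\<Sum>j<m. \<sigma> (F i x j) * b j) \<in> I"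
      by metis
    show ?thesis by (rule that[of "\<lambda>i j x. F i x j"]) (use F in auto)
  qed
  have unique: "f i j x = a j"
    if "i < m" "j < m" "\<forall>j<m. a j \<in> D" "g x * b i - (\<Sum>j<m. \<sigma> (a j) * b j) \<in> I" for i j x a
  proof -
    have "(g x * b i - (\<Sum>j<m. \<sigma> (a j) * b j)) - (g x * b i - (\<Sum>j<m. \<sigma> (f i j x) * b j)) \<in> I"
      by (rule I_diff[OF that(4) f[OF that(1)]])
    then have "(\<Sum>j<m. \<sigma> (f i j x - a j) * b j) \<in> I"
      by (simp add: \<sigma>.hom_minus left_diff_distrib sum_subtractf)
    moreover have "\<forall>j<m. f i j x - a j \<in> D"
      using that fD D_add[OF fD D_minus] by simp
    ultimately have "f i j x - a j = 0" using that indep[of "\<lambda>j. f i j x - a j" j] by blast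
    then show ?thesis by simp
  qed
  \<comment> \<open>By commutativity \<open>x\<close> may act first, which matches the order of the factors in the matrix product.\<close>
  have mult: "f i j (x * y) = (\<Sum>k<m. f i k x * f k j y)" if i: "i < m" and j: "j < m" for i j x y
  proof (rule unique[OF i j])
    show "\<forall>j<m. (\<Sum>k<m. f i k x * f k j y) \<in> D" using i by (auto intro!: D_sum D_mult fD)
    have "g y * (g x * b i - (\<Sum>k<m. \<sigma> (f i k x) * b k)) +
      (\<Sum>k<m. \<sigma> (f i k x) * (g y * b k - (\<Sum>j<m. \<sigma> (f k j y) * b j))) \<in> I"
      using i by (intro I_add I_g I_sum I_D f fD) auto
    also have "g y * (g x * b i - (\<Sum>k<m. \<sigma> (f i k x) * b k)) +
      (\<Sum>k<m. \<sigma> (f i k x) * (g y * b k - (\<Sum>j<m. \<sigma> (f k j y) * b j))) =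
      g (x * y) * b i - (\<Sum>k<m. \<Sum>j<m. \<sigma> (f i k x) * (\<sigma> (f k j y) * b j))"
      by (simp add: right_diff_distrib sum_subtractf sum_distrib_left g.hom_mult mult_ac)
    also have "(\<Sum>k<m. \<Sum>j<m. \<sigma> (f i k x) * (\<sigma> (f k j y) * b j)) =
      (\<Sum>j<m. \<sigma> (\<Sum>k<m. f i k x * f k j y) * b j)"
      by (subst sum.swap) (simp add: \<sigma>.hom_sum \<sigma>.hom_mult sum_distrib_right mult.assoc)
    finally show "g (x * y) * b i - (\<Sum>j<m. \<sigma> (\<Sum>k<m. f i k x * f k j y) * b j) \<in> I" .
  qed
  have "matrix_rep scX scC m f"
    unfolding matrix_rep_def
  proof (intro allI impI conjI)
    fix i j assume i: "i < m" and j: "j < m"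
    have delta: "(\<Sum>j<m. \<sigma> (if i = j then 1 else 0) * b j) = b i"
      using i by (simp add: if_distrib[of \<sigma>] if_distrib[of "\<lambda>z. z * _"] cong: if_cong)
    show "f i j 1 = (if i = j then 1 else 0)"
      by (rule unique[OF i j]) (use D_0 D_1 I_0 delta in auto)
    show "f i j (x + y) = f i j x + f i j y" for x y
    proof (rule unique[OF i j])
      have "(g x * b i - (\<Sum>j<m. \<sigma> (f i j x) * b j)) + (g y * b i - (\<Sum>j<m. \<sigma> (f i j y) * b j)) \<in> I"
        using f i by (intro I_add) auto
      then show "g (x + y) * b i - (\<Sum>j<m. \<sigma> (f i j x + f i j y) * b j) \<in> I"
        by (simp add: g.hom_add \<sigma>.hom_add algebra_simps sum.distrib)
    qed (use fD i D_add in auto)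
    show "f i j (scX c x) = scC c (f i j x)" for c x
      unfolding scC
    proof (rule unique[OF i j])
      have "\<sigma> (\<kappa> c) * (g x * b i - (\<Sum>j<m. \<sigma> (f i j x) * b j)) \<in> I"
        using f i by (intro I_D kD) auto
      then show "g (scX c x) * b i - (\<Sum>j<m. \<sigma> (\<kappa> c * f i j x) * b j) \<in> I"
        by (simp add: scX \<sigma>.hom_mult algebra_simps sum_distrib_left)
    qed (use fD i D_mult kD in auto)
    show "f i j (x * y) = (\<Sum>k<m. f i k x * f k j y)" for x y by (rule mult[OF i j])
  qed
  moreover have "rep_kernel m f = {x. g x \<in> I}"
  proof (intro equalityI subsetI)
    fix x assume "x \<in> rep_kernel m f"
    then have "f i j x = 0" if "i < m" "j < m" for i j using that by (simp add: rep_kernel_def)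
    then have gb: "g x * b i \<in> I" if "i < m" for i using f[OF that, of x] that by simp
    obtain a where a: "\<forall>j<m. a j \<in> D" "1 - (\<Sum>j<m. \<sigma> (a j) * b j) \<in> I" using one by blast
    have "g x * (1 - (\<Sum>j<m. \<sigma> (a j) * b j)) + (\<Sum>j<m. \<sigma> (a j) * (g x * b j)) \<in> I"
      using a(1) gb by (intro I_add I_g[OF a(2)] I_sum I_D) auto
    then show "x \<in> {x. g x \<in> I}" by (simp add: algebra_simps sum_distrib_left)
  next
    fix x assume "x \<in> {x. g x \<in> I}"
    then have "g x * b i - (\<Sum>j<m. \<sigma> 0 * b j) \<in> I" if "i < m" for i
      using I_b[OF that] by simp
    then show "x \<in> rep_kernel m f" using unique[of _ _ "\<lambda>_. 0"] D_0 by (simp add: rep_kernel_def)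
  qed
  ultimately show ?thesis by blast
qed

section \<open>Inverting a nonzero polynomial\<close>

lemma comm_ring_hom_poly_map_poly:
  assumes "comm_ring_hom h"
  shows "comm_ring_hom (\<lambda>p. poly (map_poly h p) x)"
proof -
  interpret map_poly_comm_ring_hom h using assms by (rule map_poly_comm_ring_hom.intro)
  show ?thesis by unfold_locales (auto simp: hom_distribs)
qed

lemma comm_ring_hom_to_fract: "comm_ring_hom to_fract"
  by unfold_locales auto

text \<open>
  Uniqueness of digits in base \<open>b\<close>.
\<close>

lemma weighted_sum_inj:
  fixes u v :: "nat \<Rightarrow> nat"
  assumes "\<forall>i<n. u i < b" "\<forall>i<n. v i < b" "(\<Sum>i<n. u i * b ^ i) = (\<Sum>i<n. v i * b ^ i)"
  shows "\<forall>i<n. u i = v i"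
  using assms
proof (induction n arbitrary: u v)
  case (Suc n)
  have shift: "(\<Sum>i<Suc n. w i * b ^ i) = w 0 + b * (\<Sum>i<n. w (Suc i) * b ^ i)" for w :: "nat \<Rightarrow> nat"
    by (subst sum.lessThan_Suc_shift) (simp add: sum_distrib_left mult_ac)
  have eq: "u 0 + b * (\<Sum>i<n. u (Suc i) * b ^ i) = v 0 + b * (\<Sum>i<n. v (Suc i) * b ^ i)"
    using Suc.prems(3) unfolding shift .
  have b: "u 0 < b" "v 0 < b" using Suc.prems by auto
  have "(u 0 + b * (\<Sum>i<n. u (Suc i) * b ^ i)) mod b = (v 0 + b * (\<Sum>i<n. v (Suc i) * b ^ i)) mod b"
    by (simp only: eq)
  with b have 0: "u 0 = v 0" by simp
  with eq b have "(\<Sum>i<n. u (Suc i) * b ^ i) = (\<Sum>i<n. v (Suc i) * b ^ i)" by simp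
  then have "\<forall>i<n. u (Suc i) = v (Suc i)" using Suc.prems(1,2) by (intro Suc.IH) auto
  with 0 show ?case by (auto simp: less_Suc_eq_0_disj)
qed simp

text \<open>
  Degree of a monomial after substituting \<open>t ^ (b ^ i)\<close> for the variable \<open>x\<^sub>i\<close>; the total degree
  for \<open>b = 1\<close>.
\<close>

definition monomial_weight :: "nat \<Rightarrow> (nat \<Rightarrow>\<^sub>0 nat) \<Rightarrow> nat" where
  "monomial_weight b m = (\<Sum>i\<in>Poly_Mapping.keys m. Poly_Mapping.lookup m i * b ^ i)"

text \<open>
  If \<open>b\<close> exceeds all exponents, then the exponents are the base-\<open>b\<close> digits of the weight.
\<close>

lemma separating_weight:
  fixes M :: "(nat \<Rightarrow>\<^sub>0 nat) set"
  assumes "finite M"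
  shows "\<exists>b\<ge>1. inj_on (monomial_weight b) M"
proof -
  have "finite (\<Union>m\<in>M. Poly_Mapping.keys m)" using assms by auto
  then obtain n where n: "(\<Union>m\<in>M. Poly_Mapping.keys m) \<subseteq> {..<n}"
    using finite_nat_iff_bounded by blast
  have "finite (\<Union>m\<in>M. Poly_Mapping.lookup m ` {..<n})" using assms by auto
  then obtain b where b: "(\<Union>m\<in>M. Poly_Mapping.lookup m ` {..<n}) \<subseteq> {..<b}"
    using finite_nat_iff_bounded by blast
  have weight: "monomial_weight (Suc b) m = (\<Sum>i<n. Poly_Mapping.lookup m i * Suc b ^ i)" if "m \<in> M" for m
    unfolding monomial_weight_def
    by (rule sum.mono_neutral_left) (use n that in \<open>auto simp: in_keys_iff\<close>)
  have "inj_on (monomial_weight (Suc b)) M"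
  proof (rule inj_onI)
    fix m m' assume m: "m \<in> M" "m' \<in> M" and eq: "monomial_weight (Suc b) m = monomial_weight (Suc b) m'"
    have "\<forall>i<n. Poly_Mapping.lookup m i = Poly_Mapping.lookup m' i"
      by (rule weighted_sum_inj[of _ _ "Suc b"]) (use b m eq in \<open>auto simp: weight less_Suc_eq\<close>)
    moreover have "Poly_Mapping.lookup m i = 0 \<and> Poly_Mapping.lookup m' i = 0" if "\<not> i < n" for i
      using n m that by (auto simp: subset_iff in_keys_iff)
    ultimately show "m = m'" by (metis poly_mapping_eqI)
  qed
  then show ?thesis by (intro exI[of _ "Suc b"]) simp
qed

lemma lead_coeff_sum_distinct_degrees:
  fixes f :: "'a \<Rightarrow> 'b::comm_ring_1 poly"
  assumes "finite A" "A \<noteq> {}" "inj_on (\<lambda>a. degree (f a)) A"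
  shows "\<exists>a\<in>A. coeff (\<Sum>a\<in>A. f a) (degree (f a)) = lead_coeff (f a) \<and>
    degree (\<Sum>a\<in>A. f a) \<le> degree (f a)"
proof -
  obtain a where a: "a \<in> A" "\<And>a'. a' \<in> A \<Longrightarrow> degree (f a') \<le> degree (f a)"
  proof -
    have "finite ((\<lambda>a. degree (f a)) ` A)" "(\<lambda>a. degree (f a)) ` A \<noteq> {}" using assms by auto
    from Max_in[OF this] Max_ge[OF this(1)] show ?thesis using that by fastforce
  qed
  have "coeff (\<Sum>a\<in>A. f a) (degree (f a)) = (\<Sum>a'\<in>A. coeff (f a') (degree (f a)))"
    by (rule coeff_sum)
  also have "\<dots> = coeff (f a) (degree (f a)) + (\<Sum>a'\<in>A - {a}. coeff (f a') (degree (f a)))"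
    using a assms by (simp add: sum.remove)
  also have "(\<Sum>a'\<in>A - {a}. coeff (f a') (degree (f a))) = 0"
  proof (rule sum.neutral, rule ballI)
    fix a' assume a': "a' \<in> A - {a}"
    then have "degree (f a') \<noteq> degree (f a)" using a assms(3) by (auto dest: inj_onD)
    with a(2)[of a'] a' show "coeff (f a') (degree (f a)) = 0" by (intro coeff_eq_0) auto
  qed
  finally have "coeff (\<Sum>a\<in>A. f a) (degree (f a)) = lead_coeff (f a)" by simp
  moreover have "degree (\<Sum>a\<in>A. f a) \<le> degree (f a)"
    using a assms by (intro degree_sum_le) auto
  ultimately show ?thesis using a by blast
qed

text \<open>
  The substitution \<open>x\<^sub>i \<mapsto> x\<^sub>i + u\<^sub>i\<close> on polynomials in one more variable \<open>t\<close>, which is left alone.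
  If the \<open>u\<^sub>i\<close> are polynomials in \<open>t\<close> with constant coefficients, it is an automorphism,
  with inverse \<open>x\<^sub>i \<mapsto> x\<^sub>i - u\<^sub>i\<close>.
\<close>

definition shift_hom :: "(nat \<Rightarrow> 'k::field polynomial poly) \<Rightarrow> 'k polynomial poly \<Rightarrow> 'k polynomial poly" where
  "shift_hom u G = poly (map_poly (eval_polynomial (\<lambda>c. [:pconst c:]) (\<lambda>i. [:pvar i:] + u i)) G) [:0, 1:]"

lemma const_const_hom: "comm_ring_hom (\<lambda>c::'k::field. [:pconst c:])"
  by unfold_locales (simp_all add: single_add mult_single mult.commute)

lemma shift_hom:
  fixes u :: "nat \<Rightarrow> 'k::field polynomial poly"
  shows "comm_ring_hom (shift_hom u)"
    and shift_hom_poly_const: "shift_hom u [:p:] = eval_polynomial (\<lambda>c. [:pconst c:]) (\<lambda>i. [:pvar i:] + u i) p"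
    and shift_hom_t: "shift_hom u [:0, 1:] = [:0, 1:]"
    and shift_hom_const: "shift_hom u [:pconst c:] = [:pconst c:]"
    and shift_hom_var: "shift_hom u [:pvar i:] = [:pvar i:] + u i"
proof -
  let ?e = "eval_polynomial (\<lambda>c. [:pconst c:]) (\<lambda>i. [:pvar i:] + u i)"
  have e: "comm_ring_hom ?e" by (rule eval_polynomial_hom[OF const_const_hom])
  then interpret e: comm_ring_hom ?e .
  show "comm_ring_hom (shift_hom u)"
    unfolding shift_hom_def by (rule comm_ring_hom_poly_map_poly[OF e])
  show c: "shift_hom u [:p:] = ?e p" for p
    by (simp add: shift_hom_def Polynomial.map_poly_pCons[of ?e, OF e.hom_zero])
  show "shift_hom u [:0, 1:] = [:0, 1:]"
    by (simp add: shift_hom_def Polynomial.map_poly_pCons[of ?e, OF e.hom_zero])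
  show "shift_hom u [:pconst c:] = [:pconst c:]"
    by (simp add: c eval_polynomial_const[OF const_const_hom])
  show "shift_hom u [:pvar i:] = [:pvar i:] + u i"
    by (simp add: c eval_polynomial_var[OF const_const_hom])
qed

lemma shift_hom_inverse:
  fixes u :: "nat \<Rightarrow> 'k::field polynomial poly"
  assumes u: "\<And>i. shift_hom (\<lambda>i. - u i) (u i) = u i"
  shows "shift_hom (\<lambda>i. - u i) (shift_hom u G) = G"
proof -
  interpret a: comm_ring_hom "shift_hom u" by (rule shift_hom)
  interpret b: comm_ring_hom "shift_hom (\<lambda>i. - u i)" by (rule shift_hom)
  let ?f = "\<lambda>G. shift_hom (\<lambda>i. - u i) (shift_hom u G)"
  have const: "?f [:p:] = [:p:]" for p
  proof (induction p rule: polynomial_induct)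
    case (const c) then show ?case by (simp only: shift_hom_const)
  next
    case (add p q)
    have "[:p + q:] = [:p:] + [:q:]" by simp
    then show ?case by (simp only: a.hom_add b.hom_add add)
  next
    case (mult p q)
    have "[:p * q:] = [:p:] * [:q:]" by simp
    then show ?case by (simp only: a.hom_mult b.hom_mult mult)
  next
    case (var i)
    show ?case by (simp only: shift_hom_var b.hom_add u) simp
  qed
  show ?thesis
  proof (induction G)
    case 0 then show ?case by (simp only: a.hom_zero b.hom_zero)
  next
    case (pCons p G)
    have "pCons p G = [:p:] + [:0, 1:] * G" by simp
    then show ?case
      by (simp only: a.hom_add b.hom_add a.hom_mult b.hom_mult const pCons shift_hom_t)
  qed
qed

lemma division_by_unit_lead_coeff:
  fixes F :: "'a::comm_ring_1 poly"
  assumes "lead_coeff F * c = 1"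
  shows "\<exists>Q R. G = F * Q + R \<and> (\<forall>i\<ge>degree F. coeff R i = 0)"
proof (induction G)
  case 0 then show ?case by (intro exI[of _ 0]) simp
next
  case (pCons a G)
  then obtain Q R where G: "G = F * Q + R" and R: "\<And>i. i \<ge> degree F \<Longrightarrow> coeff R i = 0" by blast
  let ?s = "c * coeff (pCons a R) (degree F)"
  have "pCons a G = F * (pCons 0 Q + [:?s:]) + (pCons a R - F * [:?s:])"
    by (simp add: G algebra_simps)
  moreover have "coeff (pCons a R - F * [:?s:]) i = 0" if "i \<ge> degree F" for i
  proof (cases "i = degree F")
    case True
    have "lead_coeff F * (c * coeff (pCons a R) (degree F)) = coeff (pCons a R) (degree F)"
      using assms by (simp add: mult.assoc[symmetric])
    then show ?thesis using True by (simp add: mult.commute)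
  next
    case False
    then have "coeff F i = 0" "coeff (pCons a R) i = 0"
      using that R by (auto simp: coeff_eq_0 coeff_pCons split: nat.splits)
    then show ?thesis by simp
  qed
  ultimately show ?case by blast
qed

text \<open>
  The kernel of \<open>t \<mapsto> 1 / h\<close> is generated by \<open>h t - 1\<close> already over the ring itself: if
  \<open>a + t G'\<close> vanishes at \<open>1 / h\<close>, so does \<open>G' + h a\<close>, whose degree is smaller, and
  \<open>a + t G' = t (G' + h a) - a (h t - 1)\<close>.
\<close>

lemma dvd_if_inverse_root:
  fixes h :: "'a::idom"
  assumes h: "h \<noteq> 0"
  shows "poly (map_poly to_fract G) (inverse (to_fract h)) = 0 \<longleftrightarrow> [:-1, h:] dvd G"
proof
  interpret e: comm_ring_hom "\<lambda>G. poly (map_poly to_fract G) (inverse (to_fract h))"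
    by (rule comm_ring_hom_poly_map_poly[OF comm_ring_hom_to_fract])
  let ?e = "\<lambda>G. poly (map_poly to_fract G) (inverse (to_fract h))"
  have pCons: "?e (pCons a G) = to_fract a + inverse (to_fract h) * ?e G" for a G
    by (simp add: Polynomial.map_poly_pCons[of to_fract, OF to_fract_0])
  show "?e G = 0" if "[:-1, h:] dvd G"
  proof -
    from that obtain Q where "G = [:-1, h:] * Q" ..
    moreover have "?e [:-1, h:] = 0" using h by (simp add: Polynomial.map_poly_pCons[of to_fract, OF to_fract_0])
    ultimately show ?thesis by (simp only: e.hom_mult mult_zero_left)
  qed
  show "[:-1, h:] dvd G" if "?e G = 0"
    using that
  proof (induction "degree G" arbitrary: G rule: less_induct)
    case less
    show ?case
    proof (cases "degree G = 0")
      case True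
      then obtain a where "G = [:a:]" by (rule degree_eq_zeroE)
      with less.prems show ?thesis by (simp add: pCons)
    next
      case False
      obtain a G' where G: "G = pCons a G'" by (cases G)
      with False have G': "G' \<noteq> 0" "degree G = Suc (degree G')" by (auto split: if_splits)
      define H where "H = G' + [:h * a:]"
      have "degree H \<le> degree G'" unfolding H_def by (rule degree_add_le) auto
      moreover have "?e H = to_fract h * ?e G"
        using h unfolding G H_def pCons e.hom_add by (simp add: Polynomial.map_poly_pCons[of to_fract, OF to_fract_0] algebra_simps)
      ultimately have dvd: "[:-1, h:] dvd H" using less G' by (intro less.hyps) auto
      have "[:-1, h:] dvd [:0, 1:] * H - [:-1, h:] * [:a:]"
        by (rule dvd_diff[OF dvd_mult[OF dvd] dvd_triv_left])
      also have "[:0, 1:] * H - [:-1, h:] * [:a:] = G" by (simp add: G H_def)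
      finally show ?thesis .
    qed
  qed
qed

text \<open>
  The localization of the polynomial ring at a nonzero \<open>h\<close> is the quotient by \<open>h t - 1\<close> after
  adjoining \<open>t\<close>. The substitution \<open>x\<^sub>i \<mapsto> x\<^sub>i + t ^ (b ^ i)\<close> (Nagata's trick for Noether
  normalization, which works over finite fields too) turns \<open>h\<close> into a polynomial whose leading
  coefficient in \<open>t\<close> is a nonzero constant, because the monomials of \<open>h\<close> get different degrees in
  \<open>t\<close>. Hence \<open>h t - 1\<close> becomes monic up to a unit, the quotient is free with basis the first powers of
  \<open>t\<close> over a polynomial ring, and its regular representation is the one wanted.
\<close>

theorem localization_representation:
  fixes h :: "'k::field polynomial"
  assumes h: "h \<noteq> 0"
  shows "\<exists>m f. matrix_rep (\<lambda>c. smult (pconst c)) poly_scale m f \<and>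
    rep_kernel m f = {G. poly (map_poly to_fract G) (inverse (to_fract h)) = 0}"
proof -
  obtain b where b: "b \<ge> 1" "inj_on (monomial_weight b) (Poly_Mapping.keys h)"
    using separating_weight[of "Poly_Mapping.keys h"] by auto
  define u :: "nat \<Rightarrow> 'k polynomial poly" where "u i = [:0, 1:] ^ (b ^ i)" for i
  interpret s: comm_ring_hom "shift_hom u" by (rule shift_hom)
  interpret s': comm_ring_hom "shift_hom (\<lambda>i. - u i)" by (rule shift_hom)
  have u': "shift_hom (\<lambda>i. - u i) (u i) = u i" for i
    unfolding u_def[of i] by (simp only: s'.hom_power shift_hom_t)
  define g where "g i = [:pvar i:] + u i" for i
  define H where "H = shift_hom u [:h:]"
  have "\<exists>c. c \<noteq> 0 \<and> lead_coeff H = pconst c"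
  proof -
    have lin: "degree ([:pvar i:] + u i) = b ^ i \<and> lead_coeff ([:pvar i:] + u i) = 1" for i
    proof -
      have d: "degree (u i) = b ^ i" by (simp add: u_def degree_power_eq)
      have l: "lead_coeff (u i) = 1" by (simp add: u_def lead_coeff_power)
      have lt: "degree [:pvar i :: 'k polynomial:] < degree (u i)" using b d by simp
      show ?thesis using degree_add_eq_right[OF lt] lead_coeff_add_le[OF lt] d l by simp
    qed
    have nz: "g i \<noteq> 0" for i
      using lin[of i] unfolding g_def by (metis leading_coeff_0_iff zero_neq_one)
    have lin_g: "degree (g i) = b ^ i" "lead_coeff (g i) = 1" for i
      unfolding g_def by (rule conjunct1[OF lin], rule conjunct2[OF lin])
    have mon: "degree (monomial_value g m) = monomial_weight b m \<and> lead_coeff (monomial_value g m) = 1" for m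
    proof
      show "degree (monomial_value g m) = monomial_weight b m"
        unfolding monomial_value_def monomial_weight_def
        by (simp add: degree_prod_eq_sum_degree degree_power_eq nz lin_g mult.commute)
      show "lead_coeff (monomial_value g m) = 1"
        unfolding monomial_value_def
        by (simp only: lead_coeff_prod lead_coeff_power lin_g(2) power_one prod.neutral_const)
    qed
    define summand where "summand m = [:pconst (Poly_Mapping.lookup h m):] * monomial_value g m" for m
    have H: "H = (\<Sum>m\<in>Poly_Mapping.keys h. summand m)"
      unfolding H_def shift_hom_poly_const eval_polynomial_def summand_def g_def ..
    have nzc: "pconst (Poly_Mapping.lookup h m) \<noteq> 0" if "m \<in> Poly_Mapping.keys h" for m
      using that by (simp add: in_keys_iff)
    have deg: "degree (summand m) = monomial_weight b m \<and> lead_coeff (summand m) = pconst (Poly_Mapping.lookup h m)"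
      if "m \<in> Poly_Mapping.keys h" for m
    proof
      show "degree (summand m) = monomial_weight b m"
        using mon[of m] nzc[OF that] by (simp add: summand_def)
      show "lead_coeff (summand m) = pconst (Poly_Mapping.lookup h m)"
        unfolding summand_def lead_coeff_mult conjunct2[OF mon] by simp
    qed
    have "inj_on (\<lambda>m. degree (summand m)) (Poly_Mapping.keys h)"
      using b(2) deg by (auto simp: inj_on_def)
    with h obtain m where m: "m \<in> Poly_Mapping.keys h"
        "coeff H (degree (summand m)) = lead_coeff (summand m)" "degree H \<le> degree (summand m)"
      using lead_coeff_sum_distinct_degrees[of "Poly_Mapping.keys h" summand] unfolding H
      by auto
    have ne: "Poly_Mapping.lookup h m \<noteq> 0" using m(1) by (simp add: in_keys_iff)
    have lc: "coeff H (degree (summand m)) = pconst (Poly_Mapping.lookup h m)"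
      using m(2) conjunct2[OF deg[OF m(1)]] by (rule trans)
    then have "coeff H (degree (summand m)) \<noteq> 0" using ne by simp
    then have "degree H = degree (summand m)" using m(3) le_degree by (metis le_antisym)
    then have "lead_coeff H = pconst (Poly_Mapping.lookup h m)" using lc by (simp only:)
    then show ?thesis using ne by blast
  qed
  then obtain c where c: "c \<noteq> 0" "lead_coeff H = pconst c" by blast
  define F where "F = pCons (-1) H"
  have sF: "shift_hom u [:-1, h:] = F"
  proof -
    have "[:-1, h:] = - 1 + [:0, 1:] * [:h:]" by (simp add: one_pCons)
    then have "shift_hom u [:-1, h:] = - 1 + [:0, 1:] * H"
      by (simp only: s.hom_add s.hom_mult s.hom_uminus s.hom_one shift_hom_t H_def)
    then show ?thesis by (simp add: F_def one_pCons)
  qed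
  have "H \<noteq> 0" using c by auto
  then have dF: "degree F > 0" and lF: "lead_coeff F = pconst c" using c by (auto simp: F_def)
  have F0: "F \<noteq> 0" using dF by auto
  have unit: "lead_coeff F * pconst (1 / c) = 1" using c by (simp add: lF mult_single)
  let ?m = "degree F"
  have expand: "R = (\<Sum>j<?m. [:coeff R j:] * monom 1 j)" if "\<forall>i\<ge>?m. coeff R i = 0" for R :: "'k polynomial poly"
  proof (rule poly_eqI)
    fix i
    have "coeff (\<Sum>j<?m. [:coeff R j:] * monom 1 j) i = (\<Sum>j<?m. if i = j then coeff R j else 0)"
      unfolding coeff_sum by (intro sum.cong) auto
    then show "coeff R i = coeff (\<Sum>j<?m. [:coeff R j:] * monom 1 j) i" using that by auto
  qed
  have remainder: "\<exists>a. F dvd G - (\<Sum>j<?m. [:a j:] * monom 1 j)" for G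
  proof -
    obtain Q R where G: "G = F * Q + R" and R: "\<forall>i\<ge>?m. coeff R i = 0"
      using division_by_unit_lead_coeff[OF unit, of G] by blast
    have "F dvd G - R" by (simp add: G)
    then have "F dvd G - (\<Sum>j<?m. [:coeff R j:] * monom 1 j)"
      by (rule subst[where P = "\<lambda>r. F dvd G - r", OF expand[OF R]])
    then show ?thesis by blast
  qed
  have "\<exists>f. matrix_rep (\<lambda>c. smult (pconst c)) poly_scale ?m f \<and>
    rep_kernel ?m f = {G. shift_hom u G \<in> {G. F dvd G}}"
  proof (rule regular_representation[where D = UNIV and \<sigma> = "\<lambda>a. [:a:]" and b = "monom 1" and \<kappa> = pconst])
    show "comm_ring_hom (shift_hom u)" by (rule shift_hom)
    show "comm_ring_hom (\<lambda>a :: 'k polynomial. [:a:])" by unfold_locales simp_all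
    show "shift_hom u (smult (pconst c) x) = [:pconst c:] * shift_hom u x" for c x
    proof -
      have "smult (pconst c) x = [:pconst c:] * x" by simp
      then show ?thesis by (simp only: s.hom_mult shift_hom_const)
    qed
    show "poly_scale c a = pconst c * a" for c and a :: "'k polynomial" by (simp add: poly_scale_def)
    show "\<exists>a. (\<forall>j<?m. a j \<in> UNIV) \<and> shift_hom u x * monom 1 i - (\<Sum>j<?m. [:a j:] * monom 1 j) \<in> {G. F dvd G}" for x i
      using remainder by auto
    show "\<exists>a. (\<forall>j<?m. a j \<in> UNIV) \<and> 1 - (\<Sum>j<?m. [:a j:] * monom 1 j) \<in> {G. F dvd G}"
      using remainder by auto
    show "a j = 0" if "(\<Sum>j<?m. [:a j:] * monom 1 j) \<in> {G. F dvd G}" "j < ?m" for a j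
    proof -
      define R where "R = (\<Sum>j<?m. [:a j:] * monom 1 j)"
      have coeff: "coeff R i = (if i < ?m then a i else 0)" for i
      proof -
        have "coeff R i = (\<Sum>j<?m. if i = j then a j else 0)"
          unfolding R_def coeff_sum by (intro sum.cong) auto
        then show ?thesis by auto
      qed
      have "degree R < ?m" using dF by (intro degree_lessI) (auto simp: coeff)
      moreover have "F dvd R" using that(1) unfolding R_def by blast
      ultimately have "R = 0" using dvd_imp_degree_le[of F R] by auto
      then show ?thesis using coeff[of j] that(2) by simp
    qed
  qed (auto intro: dvd_add dvd_mult dvd_mult2 dvd_smult)
  moreover have "F dvd shift_hom u G \<longleftrightarrow> poly (map_poly to_fract G) (inverse (to_fract h)) = 0" for G
  proof -
    have "[:-1, h:] dvd G" if "F dvd shift_hom u G"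
    proof -
      have "shift_hom (\<lambda>i. - u i) F dvd shift_hom (\<lambda>i. - u i) (shift_hom u G)"
        using that by (rule s'.hom_dvd)
      then show ?thesis unfolding sF[symmetric] shift_hom_inverse[OF u'] .
    qed
    moreover have "F dvd shift_hom u G" if "[:-1, h:] dvd G"
      using s.hom_dvd[OF that] by (simp only: sF)
    ultimately show ?thesis unfolding dvd_if_inverse_root[OF h] by blast
  qed
  ultimately show ?thesis by auto
qed

section \<open>The ascending chain condition\<close>

definition ring_ideal :: "'a::comm_ring_1 set \<Rightarrow> bool" where
  "ring_ideal I \<longleftrightarrow> 0 \<in> I \<and> (\<forall>x\<in>I. \<forall>y\<in>I. x + y \<in> I) \<and> (\<forall>a. \<forall>x\<in>I. a * x \<in> I)"

lemma ring_ideal_simps: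
  assumes "ring_ideal I"
  shows "0 \<in> I" "x \<in> I \<Longrightarrow> y \<in> I \<Longrightarrow> x + y \<in> I" "x \<in> I \<Longrightarrow> a * x \<in> I"
    "x \<in> I \<Longrightarrow> y \<in> I \<Longrightarrow> x - y \<in> I" "x \<in> I \<Longrightarrow> x * a \<in> I"
proof -
  show "0 \<in> I" using assms by (simp add: ring_ideal_def)
  show add: "x + y \<in> I" if "x \<in> I" "y \<in> I" for x y using assms that by (simp add: ring_ideal_def)
  show mult: "a * x \<in> I" if "x \<in> I" for a x using assms that by (simp add: ring_ideal_def)
  show "x * a \<in> I" if "x \<in> I" using mult[OF that, of a] by (simp add: mult.commute)
  show "x - y \<in> I" if "x \<in> I" "y \<in> I" using add[OF that(1) mult[OF that(2), of "-1"]] by simp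
qed

text \<open>
  Every sequence has a monotone subsequence, and a nonincreasing one of natural numbers is
  eventually constant.
\<close>

lemma nondecreasing_subsequence:
  fixes s :: "nat \<Rightarrow> nat"
  shows "\<exists>r :: nat \<Rightarrow> nat. strict_mono r \<and> mono (\<lambda>i. s (r i))"
proof -
  obtain f where f: "strict_mono f" "monoseq (\<lambda>n. s (f n))" using seq_monosub[of s] by blast
  from f(2) show ?thesis unfolding monoseq_def
  proof
    assume "\<forall>m. \<forall>n\<ge>m. s (f m) \<le> s (f n)"
    then have "mono (\<lambda>i. s (f i))" by (simp add: mono_def)
    then show ?thesis using f(1) by (intro exI[of _ f]) simp
  next
    assume dec: "\<forall>m. \<forall>n\<ge>m. s (f n) \<le> s (f m)"
    define N where "N = (ARG_MIN (\<lambda>n. s (f n)) n. True)"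
    have N: "s (f N) \<le> s (f n)" for n
      unfolding N_def by (rule arg_min_nat_le) simp
    have "s (f (N + i)) = s (f N)" for i using dec N by (simp add: antisym)
    moreover have "strict_mono (\<lambda>i. f (N + i))"
      using f(1) by (auto simp: strict_mono_def)
    ultimately show ?thesis by (intro exI[of _ "\<lambda>i. f (N + i)"]) (auto simp: mono_def)
  qed
qed

text \<open>
  Dickson's lemma, by passing to a subsequence nondecreasing in one more exponent at a time.
\<close>

lemma dickson:
  fixes m :: "nat \<Rightarrow> (nat \<Rightarrow>\<^sub>0 nat)"
  assumes vars: "\<And>i. Poly_Mapping.keys (m i) \<subseteq> {..<n}"
  shows "\<exists>i j c. i < j \<and> m j = c + m i"
proof -
  have "\<exists>r :: nat \<Rightarrow> nat. strict_mono r \<and> (\<forall>v<n. mono (\<lambda>i. Poly_Mapping.lookup (m (r i)) v))" for n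
  proof (induction n)
    case 0 then show ?case by (intro exI[of _ "\<lambda>i. i"]) (simp add: strict_mono_def)
  next
    case (Suc n)
    then obtain r :: "nat \<Rightarrow> nat" where r: "strict_mono r" "\<And>v. v < n \<Longrightarrow> mono (\<lambda>i. Poly_Mapping.lookup (m (r i)) v)"
      by blast
    obtain r' :: "nat \<Rightarrow> nat" where r': "strict_mono r'" "mono (\<lambda>i. Poly_Mapping.lookup (m (r (r' i))) n)"
      using nondecreasing_subsequence[of "\<lambda>i. Poly_Mapping.lookup (m (r i)) n"] by blast
    have "mono (\<lambda>i. Poly_Mapping.lookup (m (r (r' i))) v)" if "v < n" for v
      using r(2)[OF that] strict_mono_mono[OF r'(1)] by (auto simp: mono_def)
    moreover have "strict_mono (\<lambda>i. r (r' i))" using r(1) r'(1) by (auto simp: strict_mono_def)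
    ultimately show ?case using r'(2)
      by (intro exI[of _ "\<lambda>i. r (r' i)"]) (auto simp: less_Suc_eq)
  qed
  then obtain r :: "nat \<Rightarrow> nat" where r: "strict_mono r" "\<And>v. v < n \<Longrightarrow> mono (\<lambda>i. Poly_Mapping.lookup (m (r i)) v)"
    by blast
  have "Poly_Mapping.lookup (m (r 0)) v \<le> Poly_Mapping.lookup (m (r 1)) v" for v
  proof (cases "v < n")
    case True then show ?thesis using r(2)[OF True] by (auto simp: mono_def)
  next
    case False
    then have "v \<notin> Poly_Mapping.keys (m (r 0))" using vars[of "r 0"] by auto
    then show ?thesis by (simp add: in_keys_iff)
  qed
  then have "m (r 1) = (m (r 1) - m (r 0)) + m (r 0)"
    by (intro poly_mapping_eqI) (simp add: lookup_add lookup_minus)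
  moreover have "r 0 < r 1" using r(1) by (simp add: strict_mono_def)
  ultimately show ?thesis by blast
qed

lemma monomial_nonneg: "0 \<le> (m :: nat \<Rightarrow>\<^sub>0 nat)"
proof (rule ccontr)
  assume "\<not> 0 \<le> m"
  then have "m < 0" by simp
  then show False by (simp add: less_poly_mapping.rep_eq less_fun_def)
qed

text \<open>
  The lexicographic order is total, so an infinite descent is the only obstacle. By Dickson's
  lemma some monomial in it would divide a later one and so could not exceed it.
\<close>

lemma least_monomial:
  fixes Q :: "(nat \<Rightarrow>\<^sub>0 nat) set"
  assumes "m \<in> Q" and vars: "\<And>m. m \<in> Q \<Longrightarrow> Poly_Mapping.keys m \<subseteq> {..<n}"
  shows "\<exists>m\<in>Q. \<forall>m'\<in>Q. m \<le> m'"
proof (rule ccontr)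
  assume "\<not> ?thesis"
  then have "\<forall>m\<in>Q. \<exists>m'\<in>Q. m' < m" by (auto simp: not_le)
  then obtain s where s: "\<And>i. s i \<in> Q" "\<And>i. s (Suc i) < s i"
    using dependent_nat_choice[of "\<lambda>_ m. m \<in> Q" "\<lambda>_ m m'. m' < m"] assms(1) by metis
  then obtain i j c where "i < j" and c: "s j = c + s i"
    using dickson[of s n] vars by blast
  have "s j < s i"
    using \<open>i < j\<close>
  proof (induction j)
    case (Suc j) then show ?case using s(2)[of j] by (cases "i = j") auto
  qed simp
  moreover have "s i \<le> s j" using add_right_mono[OF monomial_nonneg[of c], of "s i"] by (simp add: c)
  ultimately show False by simp
qed

lemma lookup_single_times:
  fixes p :: "'k::field polynomial"
  shows "Poly_Mapping.lookup (Poly_Mapping.single c a * p) (c + k) = a * Poly_Mapping.lookup p k"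
proof -
  have "Poly_Mapping.single c a * p =
      Poly_Mapping.single c a * (\<Sum>m\<in>Poly_Mapping.keys p. Poly_Mapping.single m (Poly_Mapping.lookup p m))"
    by (simp only: sum_singles)
  also have "\<dots> = (\<Sum>m\<in>Poly_Mapping.keys p. Poly_Mapping.single (c + m) (a * Poly_Mapping.lookup p m))"
    by (simp add: sum_distrib_left mult_single)
  finally show ?thesis
    by (auto simp: lookup_sum lookup_single when_def in_keys_iff)
qed

definition leading_monomial :: "'k::field polynomial \<Rightarrow> (nat \<Rightarrow>\<^sub>0 nat)" where
  "leading_monomial p = Max (Poly_Mapping.keys p)"

lemma leading_monomial_in_keys: "p \<noteq> 0 \<Longrightarrow> leading_monomial p \<in> Poly_Mapping.keys p"
  unfolding leading_monomial_def by (intro Max_in) auto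

lemma leading_monomial_ge: "m \<in> Poly_Mapping.keys p \<Longrightarrow> m \<le> leading_monomial p"
  unfolding leading_monomial_def by (intro Max_ge) auto

text \<open>
  One step of polynomial division, by a divisor whose leading monomial divides that of \<open>p\<close>.
\<close>

lemma leading_monomial_cancel:
  fixes p q :: "'k::field polynomial"
  assumes "q \<noteq> 0" "leading_monomial p = c + leading_monomial q"
  shows "\<exists>a. \<forall>m \<in> Poly_Mapping.keys (p - Poly_Mapping.single c a * q). m < leading_monomial p"
proof -
  define a where "a = Poly_Mapping.lookup p (leading_monomial p) / Poly_Mapping.lookup q (leading_monomial q)"
  let ?r = "p - Poly_Mapping.single c a * q"
  have "Poly_Mapping.lookup q (leading_monomial q) \<noteq> 0"
    using leading_monomial_in_keys[OF assms(1)] by (simp add: in_keys_iff)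
  then have 0: "Poly_Mapping.lookup ?r (leading_monomial p) = 0"
    using lookup_single_times[of c a q "leading_monomial q"]
    by (simp add: lookup_minus assms(2) a_def)
  have "m \<le> leading_monomial p" if "m \<in> Poly_Mapping.keys ?r" for m
  proof -
    have "m \<in> Poly_Mapping.keys p \<or> m \<in> Poly_Mapping.keys (Poly_Mapping.single c a * q)"
      using that by (auto simp: in_keys_iff lookup_minus)
    then show ?thesis
    proof
      assume "m \<in> Poly_Mapping.keys (Poly_Mapping.single c a * q)"
      then obtain c' k where m: "m = c' + k" "c' \<in> Poly_Mapping.keys (Poly_Mapping.single c a)"
          "k \<in> Poly_Mapping.keys q"
        using keys_mult[of "Poly_Mapping.single c a" q] by blast
      then have "c' = c" by (auto split: if_splits)
      with m show ?thesis using leading_monomial_ge[of k q] by (simp add: assms(2) add_left_mono)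
    qed (rule leading_monomial_ge)
  qed
  then have "m < leading_monomial p" if "m \<in> Poly_Mapping.keys ?r" for m
    using that 0 by (metis in_keys_iff order_le_less)
  then show ?thesis by blast
qed

text \<open>
  Modulo an ideal that contains almost all variables only finitely many variables matter. Ideals
  of this kind stand for ideals of a polynomial ring in \<open>n\<close> variables.
\<close>

lemma reduce_variables:
  assumes I: "ring_ideal I" and vars: "\<And>v. v \<ge> n \<Longrightarrow> pvar v \<in> I"
  shows "\<exists>q\<in>polynomial_algebra {..<n}. p - q \<in> I"
proof (induction p rule: polynomial_induct)
  case (const c)
  show ?case by (rule bexI[of _ "pconst c"]) (use ring_ideal_simps[OF I] in auto)
next
  case (add p q)
  then obtain p' q' where *: "p' \<in> polynomial_algebra {..<n}" "p - p' \<in> I"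
    "q' \<in> polynomial_algebra {..<n}" "q - q' \<in> I" by blast
  have "(p - p') + (q - q') \<in> I" by (rule ring_ideal_simps(2)[OF I *(2) *(4)])
  then have "(p + q) - (p' + q') \<in> I" by (simp add: algebra_simps)
  then show ?case using * by (blast intro: polynomial_algebra_add)
next
  case (mult p q)
  then obtain p' q' where *: "p' \<in> polynomial_algebra {..<n}" "p - p' \<in> I"
    "q' \<in> polynomial_algebra {..<n}" "q - q' \<in> I" by blast
  have "q * (p - p') + p' * (q - q') \<in> I"
    by (rule ring_ideal_simps(2)[OF I ring_ideal_simps(3)[OF I *(2)] ring_ideal_simps(3)[OF I *(4)]])
  then have "p * q - p' * q' \<in> I" by (simp add: algebra_simps)
  then show ?case using * by (blast intro: polynomial_algebra_mult)
next
  case (var i)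
  show ?case
  proof (cases "i < n")
    case True
    then show ?thesis by (intro bexI[of _ "pvar i"]) (use ring_ideal_simps[OF I] in auto)
  next
    case False
    then show ?thesis by (intro bexI[of _ 0]) (use vars in auto)
  qed
qed

text \<open>
  Hilbert's basis theorem. In a strictly ascending chain pick at each step a new element with
  least possible leading monomial. By Dickson's lemma one of these leading monomials divides a later
  one, and cancelling the later leading term gives a new element with a smaller leading monomial.
\<close>

theorem ascending_chain_condition:
  fixes I :: "nat \<Rightarrow> 'k::field polynomial set"
  assumes I: "\<And>i. ring_ideal (I i)" and vars: "\<And>v. v \<ge> n \<Longrightarrow> pvar v \<in> I 0"
    and chain: "\<And>i. I i \<subset> I (Suc i)"
  shows False
proof -
  have mono: "I i \<subseteq> I j" if "i \<le> j" for i j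
    using that
  proof (induction j)
    case (Suc j) then show ?case using chain[of j] by (cases "i = Suc j") auto
  qed simp
  have "\<exists>p. p \<in> I (Suc i) - I i \<and> p \<in> polynomial_algebra {..<n} \<and>
    (\<forall>q. q \<in> I (Suc i) - I i \<longrightarrow> q \<in> polynomial_algebra {..<n} \<longrightarrow> leading_monomial p \<le> leading_monomial q)" for i
  proof -
    let ?A = "(I (Suc i) - I i) \<inter> polynomial_algebra {..<n}"
    obtain p where p: "p \<in> I (Suc i)" "p \<notin> I i" using chain[of i] by blast
    obtain q where q: "q \<in> polynomial_algebra {..<n}" "p - q \<in> I 0"
      using reduce_variables[OF I vars] by blast
    have pq: "p - q \<in> I j" for j using q mono[of 0 j] by auto
    have "p - (p - q) \<in> I (Suc i)" by (rule ring_ideal_simps(4)[OF I p(1) pq])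
    moreover have "q \<notin> I i" using ring_ideal_simps(2)[OF I pq[of i], of q] p by auto
    ultimately have "q \<in> ?A" using q by simp
    moreover have "Poly_Mapping.keys (leading_monomial q) \<subseteq> {..<n}" if "q \<in> ?A" for q
    proof -
      have "q \<noteq> 0" using that ring_ideal_simps(1)[OF I] by auto
      then show ?thesis using that leading_monomial_in_keys[of q] by (auto simp: polynomial_algebra_def)
    qed
    ultimately obtain m where "m \<in> leading_monomial ` ?A" "\<forall>m'\<in>leading_monomial ` ?A. m \<le> m'"
      using least_monomial[of "leading_monomial q" "leading_monomial ` ?A" n] by blast
    then show ?thesis by auto
  qed
  then obtain f where f: "\<And>i. f i \<in> I (Suc i)" "\<And>i. f i \<notin> I i" "\<And>i. f i \<in> polynomial_algebra {..<n}"
    and least: "\<And>i q. q \<in> I (Suc i) \<Longrightarrow> q \<notin> I i \<Longrightarrow> q \<in> polynomial_algebra {..<n} \<Longrightarrow>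
      leading_monomial (f i) \<le> leading_monomial q"
    by (metis DiffD1 DiffD2 DiffI)
  have f0: "f i \<noteq> 0" for i using f(2)[of i] ring_ideal_simps(1)[OF I] by metis
  have keys: "Poly_Mapping.keys (leading_monomial (f i)) \<subseteq> {..<n}" for i
    using f(3)[of i] leading_monomial_in_keys[OF f0, of i] by (auto simp: polynomial_algebra_def)
  obtain i j c where ij: "i < j" and c: "leading_monomial (f j) = c + leading_monomial (f i)"
    using dickson[of "\<lambda>i. leading_monomial (f i)" n] keys by blast
  obtain a where a: "\<forall>m \<in> Poly_Mapping.keys (f j - Poly_Mapping.single c a * f i). m < leading_monomial (f j)"
    using leading_monomial_cancel[OF f0 c] by blast
  let ?g = "f j - Poly_Mapping.single c a * f i"
  have "f i \<in> I j" using f(1)[of i] mono[of "Suc i" j] ij by auto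
  then have si: "Poly_Mapping.single c a * f i \<in> I j" by (rule ring_ideal_simps(3)[OF I])
  have "?g \<in> I (Suc j)"
    using f(1)[of j] si mono[of j "Suc j"] by (intro ring_ideal_simps(4)[OF I]) auto
  moreover have g: "?g \<notin> I j"
    using ring_ideal_simps(2)[OF I _ si, of ?g] f(2)[of j] by auto
  moreover have "?g \<in> polynomial_algebra {..<n}"
  proof -
    have "Poly_Mapping.keys c \<subseteq> Poly_Mapping.keys (leading_monomial (f j))"
      unfolding c by (auto simp: in_keys_iff lookup_add)
    then have "Poly_Mapping.single c a \<in> polynomial_algebra {..<n}"
      using keys[of j] by (auto simp: polynomial_algebra_def)
    then have "f j + - (Poly_Mapping.single c a * f i) \<in> polynomial_algebra {..<n}"
      using f(3) by (intro polynomial_algebra_add polynomial_algebra_uminus polynomial_algebra_mult)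
    then show ?thesis by simp
  qed
  ultimately have "leading_monomial (f j) \<le> leading_monomial ?g" by (rule least)
  moreover have "?g \<noteq> 0" using g ring_ideal_simps(1)[OF I] by metis
  then have "leading_monomial ?g < leading_monomial (f j)"
    using a leading_monomial_in_keys by blast
  ultimately show False by simp
qed

section \<open>Linear algebra modulo a subspace\<close>

text \<open>
  Bases of vector spaces modulo a subspace \<open>J\<close>, over scalars from a subfield \<open>D\<close>. The scalars are
  a subset of a field, so that they can depend on the ideal under consideration.
\<close>

locale subfield_subspace =
  fixes D J :: "'b::field set"
  assumes D_1: "1 \<in> D" and D_diff: "a \<in> D \<Longrightarrow> b \<in> D \<Longrightarrow> a - b \<in> D"
    and D_mult: "a \<in> D \<Longrightarrow> b \<in> D \<Longrightarrow> a * b \<in> D"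
    and D_inverse: "a \<in> D \<Longrightarrow> inverse a \<in> D"
    and J_0: "0 \<in> J" and J_add: "y \<in> J \<Longrightarrow> z \<in> J \<Longrightarrow> y + z \<in> J"
    and J_D: "a \<in> D \<Longrightarrow> y \<in> J \<Longrightarrow> a * y \<in> J"
begin

lemma D_0: "0 \<in> D" using D_diff[OF D_1 D_1] by simp

lemma D_minus: "a \<in> D \<Longrightarrow> - a \<in> D" using D_diff[OF D_0] by simp

lemma D_add: "a \<in> D \<Longrightarrow> b \<in> D \<Longrightarrow> a + b \<in> D" using D_diff[OF _ D_minus] by simp

definition spanned :: "('m \<Rightarrow> 'b) \<Rightarrow> 'm set \<Rightarrow> 'b \<Rightarrow> bool" where
  "spanned X M y \<longleftrightarrow> (\<exists>a. (\<forall>m. a m \<in> D) \<and> y - (\<Sum>m\<in>M. a m * X m) \<in> J)"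

definition independent :: "('m \<Rightarrow> 'b) \<Rightarrow> 'm set \<Rightarrow> bool" where
  "independent X M \<longleftrightarrow>
     (\<forall>a. (\<forall>m. a m \<in> D) \<longrightarrow> (\<Sum>m\<in>M. a m * X m) \<in> J \<longrightarrow> (\<forall>m\<in>M. a m = 0))"

lemma spanned_J: "y \<in> J \<Longrightarrow> spanned X M y"
  unfolding spanned_def by (intro exI[of _ "\<lambda>_. 0"]) (simp add: D_0)

lemma spanned_add: "spanned X M y \<Longrightarrow> spanned X M z \<Longrightarrow> spanned X M (y + z)"
  unfolding spanned_def
proof (elim exE conjE)
  fix a b assume a: "\<forall>m. a m \<in> D" "y - (\<Sum>m\<in>M. a m * X m) \<in> J"
    and b: "\<forall>m. b m \<in> D" "z - (\<Sum>m\<in>M. b m * X m) \<in> J"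
  have "(y - (\<Sum>m\<in>M. a m * X m)) + (z - (\<Sum>m\<in>M. b m * X m)) \<in> J" using a b by (intro J_add)
  then have "y + z - (\<Sum>m\<in>M. (a m + b m) * X m) \<in> J"
    by (simp add: algebra_simps sum.distrib)
  then show "\<exists>a. (\<forall>m. a m \<in> D) \<and> y + z - (\<Sum>m\<in>M. a m * X m) \<in> J"
    using a b D_add by (intro exI[of _ "\<lambda>m. a m + b m"]) simp
qed

lemma spanned_scale: "c \<in> D \<Longrightarrow> spanned X M y \<Longrightarrow> spanned X M (c * y)"
  unfolding spanned_def
proof (elim exE conjE)
  fix a assume c: "c \<in> D" and a: "\<forall>m. a m \<in> D" "y - (\<Sum>m\<in>M. a m * X m) \<in> J"
  have "c * (y - (\<Sum>m\<in>M. a m * X m)) \<in> J" using a c by (intro J_D)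
  then have "c * y - (\<Sum>m\<in>M. (c * a m) * X m) \<in> J"
    by (simp add: right_diff_distrib sum_distrib_left mult.assoc)
  then show "\<exists>a. (\<forall>m. a m \<in> D) \<and> c * y - (\<Sum>m\<in>M. a m * X m) \<in> J"
    using a c D_mult by (intro exI[of _ "\<lambda>m. c * a m"]) simp
qed

lemma spanned_sum: "(\<And>k. k \<in> A \<Longrightarrow> spanned X M (f k)) \<Longrightarrow> spanned X M (\<Sum>k\<in>A. f k)"
  by (induction A rule: infinite_finite_induct) (auto intro: spanned_add spanned_J J_0)

lemma spanned_base:
  assumes "finite M" "m \<in> M" shows "spanned X M (X m)"
proof -
  have "(\<Sum>m'\<in>M. (if m' = m then 1 else 0) * X m') = X m"
    using assms by (simp add: if_distrib[of "\<lambda>z. z * _"] cong: if_cong)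
  then show ?thesis unfolding spanned_def
    by (intro exI[of _ "\<lambda>m'. if m' = m then 1 else 0"]) (simp add: D_0 D_1 J_0)
qed

lemma independent_spanning_subset:
  assumes M: "finite M"
  shows "\<exists>B\<subseteq>M. independent X B \<and> (\<forall>y. spanned X M y \<longrightarrow> spanned X B y)"
proof -
  have "finite {B. B \<subseteq> M \<and> independent X B}" using M by simp
  moreover have "{} \<in> {B. B \<subseteq> M \<and> independent X B}" by (simp add: independent_def)
  ultimately obtain B where B: "B \<subseteq> M" "independent X B"
    and max: "\<And>B'. B' \<subseteq> M \<Longrightarrow> independent X B' \<Longrightarrow> B \<subseteq> B' \<Longrightarrow> B = B'"
    using finite_has_maximal2[of "{B. B \<subseteq> M \<and> independent X B}" "{}"] by auto
  have fB: "finite B" using B M finite_subset by blast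
  have "spanned X B (X m)" if m: "m \<in> M" for m
  proof (cases "m \<in> B")
    case False
    then have "\<not> independent X (insert m B)" using max[of "insert m B"] m B by auto
    then obtain a where a: "\<And>m. a m \<in> D" "(\<Sum>m'\<in>insert m B. a m' * X m') \<in> J"
      and ne: "\<exists>m'\<in>insert m B. a m' \<noteq> 0" unfolding independent_def by blast
    have sum: "(\<Sum>m'\<in>insert m B. a m' * X m') = a m * X m + (\<Sum>m'\<in>B. a m' * X m')"
      using fB False by simp
    \<comment> \<open>Otherwise the relation would already be one between elements of the independent set.\<close>
    have am: "a m \<noteq> 0"
    proof
      assume 0: "a m = 0"
      then have "(\<Sum>m'\<in>B. a m' * X m') \<in> J" using a(2) sum by simp
      with a(1) B(2) have "\<forall>m'\<in>B. a m' = 0" unfolding independent_def by blast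
      with 0 ne show False by simp
    qed
    have "inverse (a m) * (a m * X m + (\<Sum>m'\<in>B. a m' * X m')) \<in> J"
      using a sum by (intro J_D D_inverse) auto
    also have "inverse (a m) * (a m * X m + (\<Sum>m'\<in>B. a m' * X m')) =
        X m - (\<Sum>m'\<in>B. (- inverse (a m) * a m') * X m')"
      using am by (simp add: distrib_left sum_distrib_left sum_negf mult.assoc)
    finally show ?thesis unfolding spanned_def
      using a(1) D_mult D_minus D_inverse by (intro exI[of _ "\<lambda>m'. - inverse (a m) * a m'"]) auto
  qed (rule spanned_base[OF fB])
  then have "spanned X B y" if y: "spanned X M y" for y
  proof -
    from y obtain a where a: "\<forall>m. a m \<in> D" "y - (\<Sum>m\<in>M. a m * X m) \<in> J" unfolding spanned_def by blast
    have "spanned X B ((\<Sum>m\<in>M. a m * X m) + (y - (\<Sum>m\<in>M. a m * X m)))"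
      using a \<open>\<And>m. m \<in> M \<Longrightarrow> spanned X B (X m)\<close>
      by (intro spanned_add spanned_sum spanned_scale spanned_J[OF a(2)]) auto
    then show ?thesis by simp
  qed
  with B show ?thesis by blast
qed

end

section \<open>Primary ideals\<close>

lemma polynomial_algebra_sum:
  "(\<And>i. i \<in> A \<Longrightarrow> f i \<in> polynomial_algebra S) \<Longrightarrow> (\<Sum>i\<in>A. f i) \<in> polynomial_algebra S"
  by (induction A rule: infinite_finite_induct) (auto intro: polynomial_algebra_add)

text \<open>
  The expansion in powers of one variable is kept as a univariate polynomial \<open>G\<close>, so that for
  nonzero \<open>q\<close> the leading coefficient of \<open>G\<close> is a nonzero polynomial in the other variables.
\<close>

lemma expand_in_variable:
  assumes "q \<in> polynomial_algebra (insert j S)"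
  shows "\<exists>G. (\<forall>i. coeff G i \<in> polynomial_algebra S) \<and> poly G (pvar j) = q"
  using assms
proof (induction rule: polynomial_algebra_induct)
  case (const c)
  show ?case by (intro exI[of _ "[:pconst c:]"]) (auto simp: coeff_pCons split: nat.splits)
next
  case (add p q)
  then obtain G H where *: "\<forall>i. coeff G i \<in> polynomial_algebra S" "poly G (pvar j) = p"
    "\<forall>i. coeff H i \<in> polynomial_algebra S" "poly H (pvar j) = q" by blast
  then show ?case by (intro exI[of _ "G + H"]) (auto intro: polynomial_algebra_add)
next
  case (mult p q)
  then obtain G H where *: "\<forall>i. coeff G i \<in> polynomial_algebra S" "poly G (pvar j) = p"
    "\<forall>i. coeff H i \<in> polynomial_algebra S" "poly H (pvar j) = q" by blast
  then show ?case
    by (intro exI[of _ "G * H"])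
      (auto simp: coeff_mult intro!: polynomial_algebra_sum polynomial_algebra_mult)
next
  case (var i)
  then consider "i = j" | "i \<in> S" by blast
  then show ?case
  proof cases
    case 1 then show ?thesis by (intro exI[of _ "[:0, 1:]"]) (auto simp: coeff_pCons split: nat.splits)
  next
    case 2 then show ?thesis by (intro exI[of _ "[:pvar i:]"]) (auto simp: coeff_pCons split: nat.splits)
  qed
qed

lemma monomial_weight_add: "monomial_weight b (m + m') = monomial_weight b m + monomial_weight b m'"
proof -
  have *: "monomial_weight b k = (\<Sum>i\<in>A. Poly_Mapping.lookup k i * b ^ i)"
    if "finite A" "Poly_Mapping.keys k \<subseteq> A" for A k
    unfolding monomial_weight_def
    by (rule sum.mono_neutral_left) (use that in \<open>auto simp: in_keys_iff\<close>)
  let ?A = "Poly_Mapping.keys m \<union> Poly_Mapping.keys m'"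
  have "Poly_Mapping.keys (m + m') \<subseteq> ?A" by (rule keys_add)
  then show ?thesis by (simp add: *[of ?A] lookup_add algebra_simps sum.distrib)
qed

lemma monomial_weight_1_single [simp]: "monomial_weight (Suc 0) (Poly_Mapping.single j i) = i"
  by (cases "i = 0") (simp_all add: monomial_weight_def)

text \<open>
  Let \<open>S\<close> be a maximal set of variables that are algebraically independent modulo \<open>I\<close>, so that
  no nonzero element of the polynomial algebra on \<open>S\<close>, nor any power of it, lies in \<open>I\<close>. As \<open>I\<close> is
  primary, these elements are not zero divisors modulo \<open>I\<close>, and nothing is lost when they are
  inverted. After that, \<open>D\<close> being the field of fractions, every variable is integral over \<open>D\<close>
  modulo \<open>J\<close>, so finitely many monomials span the quotient over \<open>D\<close>. Its regular representation
  has entries in \<open>D\<close>, which is a subfield of the fractions of all polynomials.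
\<close>

theorem primary_representation:
  fixes I :: "'k::field polynomial set"
  assumes I: "ring_ideal I" and proper: "1 \<notin> I" and vars: "\<And>v. v \<ge> n \<Longrightarrow> pvar v \<in> I"
    and primary: "\<And>a b. a * b \<in> I \<Longrightarrow> a \<in> I \<or> (\<exists>k. b ^ k \<in> I)"
  shows "\<exists>m f. matrix_rep poly_scale (\<lambda>c x. to_fract (pconst c) * x) m f \<and> rep_kernel m f = I"
proof -
  let ?S = "{S. S \<subseteq> {..<n} \<and> polynomial_algebra S \<inter> I \<subseteq> {0}}"
  have "{} \<in> ?S"
  proof -
    have "p = 0" if p: "p \<in> polynomial_algebra {}" "p \<in> I" for p
    proof (rule ccontr)
      assume "p \<noteq> 0"
      from p(1) obtain c where c: "p = pconst c" by (rule polynomial_algebra_empty_const)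
      with \<open>p \<noteq> 0\<close> have "c \<noteq> 0" by auto
      have "pconst (1 / c) * p \<in> I" using p(2) by (rule ring_ideal_simps(3)[OF I])
      then show False using \<open>c \<noteq> 0\<close> proper by (simp add: c mult_single)
    qed
    then show ?thesis by auto
  qed
  then obtain S where S: "S \<subseteq> {..<n}" "polynomial_algebra S \<inter> I \<subseteq> {0}"
    and maxS: "\<And>S'. S' \<subseteq> {..<n} \<Longrightarrow> polynomial_algebra S' \<inter> I \<subseteq> {0} \<Longrightarrow> S \<subseteq> S' \<Longrightarrow> S = S'"
    using finite_has_maximal2[of ?S "{}"] by auto
  define A :: "'k polynomial set" where "A = polynomial_algebra S - {0}"
  define D :: "'k polynomial fract set" where "D = {to_fract a / to_fract b | a b. a \<in> polynomial_algebra S \<and> b \<in> A}"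
  define J :: "'k polynomial fract set" where "J = {to_fract p / to_fract b | p b. p \<in> I \<and> b \<in> A}"
  have A_1: "1 \<in> A" by (simp add: A_def)
  have A_mult: "a * b \<in> A" if "a \<in> A" "b \<in> A" for a b
    using that by (auto simp: A_def polynomial_algebra_mult)
  have A_0: "a \<noteq> 0" if "a \<in> A" for a using that by (simp add: A_def)
  have A_S: "a \<in> polynomial_algebra S" if "a \<in> A" for a using that by (simp add: A_def)
  have cancel: "p \<in> I" if "p * b \<in> I" "b \<in> A" for p b
  proof -
    have "b ^ k \<in> A" for k using that(2) by (induction k) (auto intro: A_1 A_mult)
    then have "b ^ k \<notin> I" for k using S(2) by (force simp: A_def)
    then show ?thesis using primary[OF that(1)] by blast
  qed
  have DI: "to_fract a / to_fract b \<in> D" if "a \<in> polynomial_algebra S" "b \<in> A" for a b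
    using that by (auto simp: D_def)
  have DI1: "to_fract a \<in> D" if "a \<in> polynomial_algebra S" for a
    using DI[OF that A_1] by simp
  have JI: "to_fract p / to_fract b \<in> J" if "p \<in> I" "b \<in> A" for p b
    using that by (auto simp: J_def)
  have JI1: "to_fract p \<in> J" if "p \<in> I" for p using JI[OF that A_1] by simp
  have J_iff: "to_fract p \<in> J \<longleftrightarrow> p \<in> I" for p
  proof
    assume "to_fract p \<in> J"
    then obtain q b where "q \<in> I" and b: "b \<in> A" and eq: "to_fract p = to_fract q / to_fract b"
      by (auto simp: J_def)
    from eq A_0[OF b] have "to_fract (p * b) = to_fract q" by (simp add: field_simps)
    then have "p * b = q" by (simp only: to_fract_eq_iff)
    with \<open>q \<in> I\<close> b show "p \<in> I" using cancel by blast
  qed (rule JI1)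
  interpret subfield_subspace D J
  proof
    show "1 \<in> D" using DI1[of 1] by simp
    show "a - b \<in> D" if ab: "a \<in> D" "b \<in> D" for a b
    proof -
      from ab obtain p q r s where *: "p \<in> polynomial_algebra S" "q \<in> A" "a = to_fract p / to_fract q"
        "r \<in> polynomial_algebra S" "s \<in> A" "b = to_fract r / to_fract s" by (auto simp: D_def)
      have "a - b = to_fract (p * s + - (r * q)) / to_fract (q * s)"
        unfolding *(3,6) using A_0[OF *(2)] A_0[OF *(5)] by (simp add: field_simps)
      also have "\<dots> \<in> D"
        by (intro DI A_mult polynomial_algebra_add polynomial_algebra_uminus polynomial_algebra_mult
            *(1,2,4,5) A_S[OF *(2)] A_S[OF *(5)])
      finally show ?thesis .
    qed
    show "a * b \<in> D" if ab: "a \<in> D" "b \<in> D" for a b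
    proof -
      from ab obtain p q r s where *: "p \<in> polynomial_algebra S" "q \<in> A" "a = to_fract p / to_fract q"
        "r \<in> polynomial_algebra S" "s \<in> A" "b = to_fract r / to_fract s" by (auto simp: D_def)
      have "a * b = to_fract (p * r) / to_fract (q * s)" using * by simp
      also have "\<dots> \<in> D" using * by (intro DI A_mult polynomial_algebra_mult)
      finally show ?thesis .
    qed
    show "inverse a \<in> D" if a: "a \<in> D" for a
    proof -
      from a obtain p q where *: "p \<in> polynomial_algebra S" "q \<in> A" "a = to_fract p / to_fract q"
        by (auto simp: D_def)
      show ?thesis
      proof (cases "p = 0")
        case True then show ?thesis using DI1[of 0] * by simp
      next
        case False
        then have "to_fract q / to_fract p \<in> D" using * by (intro DI) (auto simp: A_def)
        then show ?thesis using * by simp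
      qed
    qed
    show "0 \<in> J" using JI1[OF ring_ideal_simps(1)[OF I]] by simp
    show "y + z \<in> J" if yz: "y \<in> J" "z \<in> J" for y z
    proof -
      from yz obtain p q r s where *: "p \<in> I" "q \<in> A" "y = to_fract p / to_fract q"
        "r \<in> I" "s \<in> A" "z = to_fract r / to_fract s" by (auto simp: J_def)
      have "y + z = to_fract (s * p + q * r) / to_fract (q * s)"
        unfolding *(3,6) using A_0[OF *(2)] A_0[OF *(5)] by (simp add: field_simps)
      also have "\<dots> \<in> J"
        by (intro JI A_mult ring_ideal_simps(2)[OF I] ring_ideal_simps(3)[OF I] *)
      finally show ?thesis .
    qed
    show "a * y \<in> J" if ay: "a \<in> D" "y \<in> J" for a y
    proof -
      from ay obtain p q r s where *: "p \<in> polynomial_algebra S" "q \<in> A" "a = to_fract p / to_fract q"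
        "r \<in> I" "s \<in> A" "y = to_fract r / to_fract s" by (auto simp: D_def J_def)
      have "a * y = to_fract (p * r) / to_fract (q * s)" using * by simp
      also have "\<dots> \<in> J" by (intro JI A_mult ring_ideal_simps(3)[OF I] *)
      finally show ?thesis .
    qed
  qed
  have J_P: "to_fract p * y \<in> J" if y: "y \<in> J" for p y
  proof -
    from y obtain r s where *: "r \<in> I" "s \<in> A" "y = to_fract r / to_fract s" by (auto simp: J_def)
    have "to_fract p * y = to_fract (p * r) / to_fract s" using * by simp
    also have "\<dots> \<in> J" by (intro JI ring_ideal_simps(3)[OF I] *)
    finally show ?thesis .
  qed
  \<comment> \<open>Degree 1 for the variables from \<open>n\<close> on, which lie in \<open>I\<close>, will keep the spanning set of monomials finite.\<close>
  define integral where "integral j e a \<longleftrightarrow> (\<forall>i. a i \<in> D) \<and>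
    to_fract (pvar j) ^ e - (\<Sum>i<e. a i * to_fract (pvar j) ^ i) \<in> J \<and> (j \<ge> n \<longrightarrow> e = 1)" for j e a
  have "\<exists>e a. integral j e a" for j
  proof -
    consider "j \<ge> n" | "j \<in> S" | "j < n" "j \<notin> S" by fastforce
    then show ?thesis
    proof cases
      case 1
      then show ?thesis unfolding integral_def using JI1[OF vars[OF 1]]
        by (intro exI[of _ 1] exI[of _ "\<lambda>_. 0"]) (simp add: D_0)
    next
      case 2
      then show ?thesis unfolding integral_def using S(1)
        by (intro exI[of _ 1] exI[of _ "\<lambda>_. to_fract (pvar j)"]) (auto simp: DI1 J_0)
    next
      case 3
      then have "\<not> polynomial_algebra (insert j S) \<inter> I \<subseteq> {0}" using maxS[of "insert j S"] S(1) by auto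
      then obtain q where q: "q \<in> polynomial_algebra (insert j S)" "q \<in> I" "q \<noteq> 0" by blast
      obtain G where G: "\<And>i. coeff G i \<in> polynomial_algebra S" "poly G (pvar j) = q"
        using expand_in_variable[OF q(1)] by blast
      let ?l = "lead_coeff G" and ?e = "degree G" and ?x = "to_fract (pvar j) :: 'k polynomial fract"
      have "G \<noteq> 0" using G(2) q(3) by auto
      then have l: "?l \<in> A" using G(1) by (simp add: A_def)
      have "to_fract q / to_fract ?l = (\<Sum>i\<le>?e. to_fract (coeff G i) / to_fract ?l * ?x ^ i)"
      proof -
        interpret f: comm_ring_hom "to_fract :: 'k polynomial \<Rightarrow> _" by (rule comm_ring_hom_to_fract)
        show ?thesis unfolding G(2)[symmetric] poly_altdef
          by (simp add: f.hom_sum f.hom_power sum_divide_distrib)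
      qed
      also have "\<dots> = ?x ^ ?e - (\<Sum>i<?e. - (to_fract (coeff G i) / to_fract ?l) * ?x ^ i)"
        using A_0[OF l] by (simp add: lessThan_Suc_atMost[symmetric] sum_negf)
      finally have "?x ^ ?e - (\<Sum>i<?e. - (to_fract (coeff G i) / to_fract ?l) * ?x ^ i) \<in> J"
        using JI[OF q(2) l] by simp
      then show ?thesis unfolding integral_def using 3 G(1) l
        by (intro exI[of _ ?e] exI[of _ "\<lambda>i. - (to_fract (coeff G i) / to_fract ?l)"])
          (auto intro!: D_minus DI)
    qed
  qed
  then have "\<forall>j. \<exists>e. \<exists>a. integral j e a" by blast
  from choice[OF this] obtain e where "\<forall>j. \<exists>a. integral j (e j) a" by blast
  from choice[OF this] obtain a where integral: "integral j (e j) (a j)" for j by blast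
  have a: "a j i \<in> D"
    and alg: "to_fract (pvar j) ^ e j - (\<Sum>i<e j. a j i * to_fract (pvar j) ^ i) \<in> J"
    and e: "j \<ge> n \<Longrightarrow> e j = 1" for i j
    using integral[of j] by (simp_all add: integral_def)
  \<comment> \<open>A monomial outside this set has a factor that can be rewritten by monomials of lower total degree.\<close>
  define M where "M = {m. \<forall>j. Poly_Mapping.lookup m j < e j}"
  define X :: "(nat \<Rightarrow>\<^sub>0 nat) \<Rightarrow> 'k polynomial fract" where "X m = to_fract (monomial_value pvar m)" for m
  have X_add: "X (m + m') = X m * X m'" for m m' by (simp add: X_def monomial_value_add)
  have X_single: "X (Poly_Mapping.single j i) = to_fract (pvar j) ^ i" for j i
  proof -
    interpret f: comm_ring_hom "to_fract :: 'k polynomial \<Rightarrow> _" by (rule comm_ring_hom_to_fract)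
    show ?thesis by (simp add: X_def f.hom_power)
  qed
  have fM: "finite M"
  proof -
    have "Poly_Mapping.lookup ` M \<subseteq>
      {f. \<forall>j. (j \<in> {..<n} \<longrightarrow> f j \<in> {..<Max (insert 0 (e ` {..<n}))}) \<and> (j \<notin> {..<n} \<longrightarrow> f j = 0)}"
    proof (clarify, intro conjI impI)
      fix m j assume m: "m \<in> M"
      then have lt: "Poly_Mapping.lookup m j < e j" by (simp add: M_def)
      show "Poly_Mapping.lookup m j \<in> {..<Max (insert 0 (e ` {..<n}))}" if "j \<in> {..<n}"
      proof -
        have "e j \<le> Max (insert 0 (e ` {..<n}))" using that by (intro Max_ge) auto
        with lt show ?thesis by simp
      qed
      show "Poly_Mapping.lookup m j = 0" if "j \<notin> {..<n}"
        using lt e[of j] that by simp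
    qed
    then have "finite (Poly_Mapping.lookup ` M)"
      by (rule finite_subset) (rule finite_set_of_finite_funs; simp)
    moreover have "inj_on Poly_Mapping.lookup M" by (auto simp: inj_on_def lookup_inject)
    ultimately show ?thesis by (rule finite_imageD)
  qed
  have spanX: "spanned X M (X m)" for m
  proof (induction "monomial_weight 1 m" arbitrary: m rule: less_induct)
    case less
    show ?case
    proof (cases "m \<in> M")
      case True then show ?thesis by (rule spanned_base[OF fM])
    next
      case False
      then obtain j where j: "e j \<le> Poly_Mapping.lookup m j" by (auto simp: M_def not_less)
      define m' where "m' = m - Poly_Mapping.single j (e j)"
      have m: "m = m' + Poly_Mapping.single j (e j)"
        by (rule poly_mapping_eqI) (use j in \<open>auto simp: m'_def lookup_add lookup_minus lookup_single when_def\<close>)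
      let ?x = "to_fract (pvar j) :: 'k polynomial fract"
      have "spanned X M (X (m' + Poly_Mapping.single j i))" if "i < e j" for i
        by (rule less) (use that in \<open>simp add: m monomial_weight_add\<close>)
      then have "spanned X M (\<Sum>i<e j. a j i * X (m' + Poly_Mapping.single j i))"
        by (intro spanned_sum spanned_scale a) simp
      moreover have "spanned X M (X m' * (?x ^ e j - (\<Sum>i<e j. a j i * ?x ^ i)))"
        unfolding X_def[of m'] by (intro spanned_J J_P alg)
      ultimately have "spanned X M ((\<Sum>i<e j. a j i * X (m' + Poly_Mapping.single j i)) +
          X m' * (?x ^ e j - (\<Sum>i<e j. a j i * ?x ^ i)))"
        by (rule spanned_add)
      also have "(\<Sum>i<e j. a j i * X (m' + Poly_Mapping.single j i)) +
          X m' * (?x ^ e j - (\<Sum>i<e j. a j i * ?x ^ i)) = X m"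
        by (simp add: m X_add X_single right_diff_distrib sum_distrib_left mult_ac)
      finally show ?thesis .
    qed
  qed
  have spanM: "spanned X M (to_fract p)" for p
  proof -
    have "to_fract p = (\<Sum>m\<in>Poly_Mapping.keys p. to_fract (pconst (Poly_Mapping.lookup p m)) * X m)"
    proof -
      have "to_fract p = to_fract (\<Sum>m\<in>Poly_Mapping.keys p. Poly_Mapping.single m (Poly_Mapping.lookup p m))"
        by (simp only: sum_singles)
      also have "\<dots> = (\<Sum>m\<in>Poly_Mapping.keys p. to_fract (Poly_Mapping.single m (Poly_Mapping.lookup p m)))"
        by (rule to_fract_sum)
      also have "\<dots> = (\<Sum>m\<in>Poly_Mapping.keys p. to_fract (pconst (Poly_Mapping.lookup p m)) * X m)"
        unfolding X_def to_fract_mult[symmetric] single_eq_const_times[symmetric] ..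
      finally show ?thesis .
    qed
    also have "spanned X M \<dots>" by (intro spanned_sum spanned_scale spanX DI1) simp
    finally show ?thesis .
  qed
  obtain B where B: "B \<subseteq> M" "independent X B" and spanB: "\<And>y. spanned X M y \<Longrightarrow> spanned X B y"
    using independent_spanning_subset[OF fM, of X] by blast
  have "finite B" using B(1) fM finite_subset by blast
  then obtain h where h: "bij_betw h {0..<card B} B" using ex_bij_betw_nat_finite by blast
  then have h: "bij_betw h {..<card B} B" by (simp add: lessThan_atLeast0)
  let ?m = "card B"
  have coords: "\<exists>a. (\<forall>j<?m. a j \<in> D) \<and> to_fract p - (\<Sum>j<?m. a j * X (h j)) \<in> J" for p
  proof -
    from spanB[OF spanM[of p]] obtain a where a: "\<And>m. a m \<in> D" "to_fract p - (\<Sum>m\<in>B. a m * X m) \<in> J"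
      unfolding spanned_def by blast
    have "(\<Sum>j<?m. a (h j) * X (h j)) = (\<Sum>m\<in>B. a m * X m)"
      by (rule sum.reindex_bij_betw[OF h])
    then show ?thesis using a by (intro exI[of _ "\<lambda>j. a (h j)"]) simp
  qed
  have "\<exists>f. matrix_rep poly_scale (\<lambda>c x. to_fract (pconst c) * x) ?m f \<and>
    rep_kernel ?m f = {x. to_fract x \<in> J}"
  proof (rule regular_representation[where D = D and \<sigma> = "\<lambda>x. x" and b = "\<lambda>j. X (h j)" and
        \<kappa> = "\<lambda>c. to_fract (pconst c)"])
    show "comm_ring_hom to_fract" by (rule comm_ring_hom_to_fract)
    show "comm_ring_hom (\<lambda>x::'k polynomial fract. x)" by unfold_locales auto
    show "y * X (h i) \<in> J" if "y \<in> J" for i y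
      using J_P[OF that, of "monomial_value pvar (h i)"] by (simp add: X_def mult.commute)
    show "\<exists>a. (\<forall>j<?m. a j \<in> D) \<and> to_fract x * X (h i) - (\<Sum>j<?m. a j * X (h j)) \<in> J" for x i
      using coords[of "x * monomial_value pvar (h i)"] by (simp add: X_def)
    show "\<exists>a. (\<forall>j<?m. a j \<in> D) \<and> 1 - (\<Sum>j<?m. a j * X (h j)) \<in> J"
      using coords[of 1] by simp
    show "a j = 0" if a: "\<forall>j<?m. a j \<in> D" "(\<Sum>j<?m. a j * X (h j)) \<in> J" "j < ?m" for a j
    proof -
      define k where "k = the_inv_into {..<?m} h"
      have kh: "k (h j) = j" if "j < ?m" for j
        using h that unfolding k_def by (simp add: the_inv_into_f_f bij_betw_def)
      define a' where "a' m = (if k m < ?m then a (k m) else 0)" for m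
      have "(\<Sum>m\<in>B. a' m * X m) = (\<Sum>j<?m. a' (h j) * X (h j))"
        by (rule sum.reindex_bij_betw[OF h, symmetric])
      also have "\<dots> = (\<Sum>j<?m. a j * X (h j))"
        by (intro sum.cong refl) (simp add: a'_def kh)
      finally have "(\<Sum>m\<in>B. a' m * X m) \<in> J" using a(2) by simp
      moreover have "\<forall>m. a' m \<in> D" using a(1) D_0 by (simp add: a'_def)
      ultimately have "\<forall>m\<in>B. a' m = 0" using B(2) unfolding independent_def by blast
      moreover have "h j \<in> B" using h a(3) by (auto simp: bij_betw_def)
      ultimately show ?thesis using a(3) kh[OF a(3)] by (force simp: a'_def)
    qed
    show "to_fract (poly_scale c x) = to_fract (pconst c) * to_fract x" for c :: 'k and x
      by (simp add: poly_scale_def)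
  qed (auto intro: J_0 J_add J_P J_D D_0 D_1 D_add D_mult D_minus DI1)
  then show ?thesis by (auto simp: J_iff)
qed

section \<open>Every ideal is the kernel of a matrix representation over polynomials\<close>

lemma common_denominator:
  fixes E :: "'a::idom fract set"
  assumes "finite E"
  shows "\<exists>h. h \<noteq> 0 \<and> (\<forall>x\<in>E. \<exists>p. x = to_fract p / to_fract h)"
  using assms
proof (induction E rule: finite_induct)
  case empty
  show ?case by (intro exI[of _ 1]) simp
next
  case (insert y E)
  then obtain h where h: "h \<noteq> 0" "\<And>x. x \<in> E \<Longrightarrow> \<exists>p. x = to_fract p / to_fract h" by blast
  obtain a b where y: "y = Fract a b" "b \<noteq> 0" by (cases y) auto
  have "\<exists>p. x = to_fract p / to_fract (h * b)" if x: "x \<in> insert y E" for x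
  proof (cases "x = y")
    case True
    then have "x = to_fract (a * h) / to_fract (h * b)" using y h(1) by (simp add: Fract_conv_to_fract)
    then show ?thesis ..
  next
    case False
    then obtain p where "x = to_fract p / to_fract h" using x h(2) by blast
    then have "x = to_fract (p * b) / to_fract (h * b)" using y(2) by simp
    then show ?thesis ..
  qed
  then show ?case using h(1) y(2) by (intro exI[of _ "h * b"]) simp
qed

text \<open>
  All entries of all matrices are polynomials in the entries for the finitely many variables
  outside the kernel, so they lie in the localization at a common denominator \<open>h\<close>, which itself
  has a faithful representation over polynomials.
\<close>

lemma descend_to_polynomials:
  fixes f :: "nat \<Rightarrow> nat \<Rightarrow> 'k::field polynomial \<Rightarrow> 'k polynomial fract"
  assumes f: "matrix_rep poly_scale (\<lambda>c x. to_fract (pconst c) * x) m f"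
    and vars: "\<And>v. v \<ge> n \<Longrightarrow> pvar v \<in> rep_kernel m f"
  shows "\<exists>d g. matrix_rep poly_scale (poly_scale :: 'k \<Rightarrow> _) d g \<and> rep_kernel d g = rep_kernel m f"
proof -
  let ?E = "(\<lambda>(i, j, v). f i j (pvar v)) ` ({..<m} \<times> {..<m} \<times> {..<n})"
  have "finite ?E" by simp
  from common_denominator[OF this] obtain h where h: "h \<noteq> 0"
    and E: "\<And>x. x \<in> ?E \<Longrightarrow> \<exists>p. x = to_fract p / to_fract h" by blast
  have frac: "\<exists>p. f i j (pvar v) = to_fract p / to_fract h" if "i < m" "j < m" "v < n" for i j v
    by (rule E) (use that in force)
  define ev where "ev G = poly (map_poly to_fract G) (inverse (to_fract h))" for G
  have ev_hom: "comm_ring_hom ev"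
    unfolding ev_def by (rule comm_ring_hom_poly_map_poly[OF comm_ring_hom_to_fract])
  interpret ev: comm_ring_hom ev by (rule ev_hom)
  have ev_const: "ev [:p:] = to_fract p" for p
    by (simp add: ev_def Polynomial.map_poly_pCons[of to_fract, OF to_fract_0])
  have ev_over: "ev [:0, p:] = to_fract p / to_fract h" for p
    by (simp add: ev_def Polynomial.map_poly_pCons[of to_fract, OF to_fract_0] divide_inverse mult.commute)
  have add: "x + y \<in> range ev" if "x \<in> range ev" "y \<in> range ev" for x y
    using that by (auto simp flip: ev.hom_add)
  have mult: "x * y \<in> range ev" if "x \<in> range ev" "y \<in> range ev" for x y
    using that by (auto simp flip: ev.hom_mult)
  have zero: "0 \<in> range ev" by (metis ev.hom_zero rangeI)
  have const: "to_fract p \<in> range ev" for p by (metis ev_const rangeI)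
  have sum: "(\<Sum>k\<in>A. F k) \<in> range ev" if "\<And>k. k \<in> A \<Longrightarrow> F k \<in> range ev" for F and A :: "nat set"
    using that by (induction A rule: infinite_finite_induct) (auto intro: add zero)
  have "\<forall>i<m. \<forall>j<m. f i j p \<in> range ev" for p
  proof (induction p rule: polynomial_induct)
    case (const c)
    have "f i j (pconst c) = to_fract (pconst c) * (if i = j then 1 else 0)" if "i < m" "j < m" for i j
      using matrix_rep_simps(4)[OF f that, of c 1] matrix_rep_simps(1)[OF f that]
      by (simp add: poly_scale_def)
    then show ?case using \<open>\<And>p. to_fract p \<in> range ev\<close> zero by simp
  next
    case (add p q)
    then show ?case using \<open>\<And>x y. x \<in> range ev \<Longrightarrow> y \<in> range ev \<Longrightarrow> x + y \<in> range ev\<close>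
      by (simp add: matrix_rep_simps(2)[OF f])
  next
    case (mult p q)
    then show ?case
      by (auto simp: matrix_rep_simps(3)[OF f]
          intro!: sum \<open>\<And>x y. x \<in> range ev \<Longrightarrow> y \<in> range ev \<Longrightarrow> x * y \<in> range ev\<close>)
  next
    case (var v)
    show ?case
    proof (cases "v < n")
      case True then show ?thesis using frac ev_over by (metis rangeI)
    next
      case False
      then show ?thesis using vars[of v] zero by (simp add: rep_kernel_def)
    qed
  qed
  then have entries: "f i j p \<in> range ev" if "i < m" "j < m" for i j p using that by blast
  have scale: "ev (smult (pconst c) G) = to_fract (pconst c) * ev G" for c G
  proof -
    have "smult (pconst c) G = [:pconst c:] * G" by simp
    then show ?thesis by (simp only: ev.hom_mult ev_const)
  qed
  obtain e g where g: "matrix_rep (\<lambda>c. smult (pconst c)) (poly_scale :: 'k \<Rightarrow> _) e g"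
    "rep_kernel e g = {G. ev G = 0}"
    using localization_representation[OF h] unfolding ev_def by blast
  show ?thesis
    by (rule matrix_rep_compose[OF f entries ev_hom scale g])
qed

text \<open>
  Noether's argument. When the quotients \<open>I : b ^ k\<close> have become stationary at \<open>k\<close>, the ideal \<open>I\<close> is the
  intersection of \<open>I + (a)\<close> and \<open>I + (b ^ k)\<close>.
\<close>

lemma primary_if_irreducible:
  fixes I :: "'k::field polynomial set"
  assumes I: "ring_ideal I" and vars: "\<And>v. v \<ge> n \<Longrightarrow> pvar v \<in> I"
    and irreducible: "\<And>J1 J2. ring_ideal J1 \<Longrightarrow> ring_ideal J2 \<Longrightarrow> J1 \<inter> J2 = I \<Longrightarrow> J1 = I \<or> J2 = I"
    and ab: "a * b \<in> I"
  shows "a \<in> I \<or> (\<exists>k. b ^ k \<in> I)"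
proof -
  note Is = ring_ideal_simps[OF I]
  define J where "J k = {r. r * b ^ k \<in> I}" for k
  have J_ideal: "ring_ideal (J k)" for k
    unfolding ring_ideal_def J_def
    using Is(1,2,3) by (auto simp: distrib_right mult.assoc)
  have J_Suc: "J k \<subseteq> J (Suc k)" for k
  proof
    fix r assume "r \<in> J k"
    then have "r * b ^ k \<in> I" by (simp add: J_def)
    then have "b * (r * b ^ k) \<in> I" by (rule Is(3))
    then show "r \<in> J (Suc k)" by (simp add: J_def mult.left_commute)
  qed
  have "\<exists>k. J k = J (Suc k)"
  proof (rule ccontr)
    assume "\<not> ?thesis"
    with J_Suc have strict: "J k \<subset> J (Suc k)" for k by blast
    have "pvar v \<in> J 0" if "v \<ge> n" for v using vars[OF that] by (simp add: J_def)
    from ascending_chain_condition[OF J_ideal this strict] show False .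
  qed
  then obtain k where k: "J k = J (Suc k)" by blast
  define gen where "gen x = {i + r * x | i r. i \<in> I}" for x
  have gen_ideal: "ring_ideal (gen x)" for x
    unfolding ring_ideal_def
  proof (intro conjI ballI allI)
    show "0 \<in> gen x" unfolding gen_def using Is(1) by (auto intro!: exI[of _ 0])
    show "y + z \<in> gen x" if yz: "y \<in> gen x" "z \<in> gen x" for y z
    proof -
      from yz obtain i r j s where *: "y = i + r * x" "i \<in> I" "z = j + s * x" "j \<in> I"
        by (auto simp: gen_def)
      have "y + z = (i + j) + (r + s) * x" by (simp add: * algebra_simps)
      moreover have "i + j \<in> I" using *(2,4) by (rule Is(2))
      ultimately show ?thesis unfolding gen_def by blast
    qed
    show "c * y \<in> gen x" if y: "y \<in> gen x" for c y
    proof -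
      from y obtain i r where y: "y = i + r * x" and i: "i \<in> I" by (auto simp: gen_def)
      have "c * y = c * i + (c * r) * x" by (simp add: y algebra_simps)
      moreover have "c * i \<in> I" using i by (rule Is(3))
      ultimately show ?thesis unfolding gen_def by blast
    qed
  qed
  have genI: "i + r * x \<in> gen x" if "i \<in> I" for i r x unfolding gen_def using that by blast
  have gen_I: "I \<subseteq> gen x" for x using genI[of _ 0 x] by auto
  have gen_x: "x \<in> gen x" for x using genI[OF Is(1), of 1 x] by simp
  have "gen a \<inter> gen (b ^ k) \<subseteq> I"
  proof
    fix y assume y: "y \<in> gen a \<inter> gen (b ^ k)"
    then obtain i r j s where *: "y = i + r * a" "i \<in> I" "y = j + s * b ^ k" "j \<in> I"
      unfolding gen_def by blast
    have "b * i + r * (a * b) - b * j \<in> I" by (intro Is(4) Is(2) Is(3) * ab)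
    also have "b * i + r * (a * b) - b * j = b * (i + r * a) - b * j" by (simp add: algebra_simps)
    also have "\<dots> = b * (j + s * b ^ k) - b * j" using *(1,3) by simp
    also have "\<dots> = s * b ^ Suc k" by (simp add: algebra_simps)
    finally have "s \<in> J (Suc k)" by (simp add: J_def)
    then have "s \<in> J k" by (simp only: k)
    then have "s * b ^ k \<in> I" by (simp add: J_def)
    then show "y \<in> I" unfolding *(3) using *(4) by (intro Is(2))
  qed
  with gen_I have "gen a \<inter> gen (b ^ k) = I" by blast
  then have "gen a = I \<or> gen (b ^ k) = I" using irreducible gen_ideal by blast
  then show ?thesis using gen_x by blast
qed

text \<open>
  Noetherian induction: a proper ideal is an intersection of two larger ideals, or irreducible and
  therefore primary.
\<close>

theorem ideal_representation:
  fixes I :: "'k::field polynomial set"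
  assumes "ring_ideal I" and "\<And>v. v \<ge> n \<Longrightarrow> pvar v \<in> I"
  shows "\<exists>d f. matrix_rep poly_scale (poly_scale :: 'k \<Rightarrow> _) d f \<and> rep_kernel d f = I"
proof -
  define R where "R = {(J, I :: 'k polynomial set).
    ring_ideal I \<and> ring_ideal J \<and> (\<forall>v\<ge>n. pvar v \<in> I) \<and> I \<subset> J}"
  have "wf R"
    unfolding wf_iff_no_infinite_down_chain
  proof
    assume "\<exists>f. \<forall>i. (f (Suc i), f i) \<in> R"
    then obtain f where f: "\<And>i. (f (Suc i), f i) \<in> R" by blast
    show False by (rule ascending_chain_condition[of f n]) (use f in \<open>auto simp: R_def\<close>)
  qed
  then show ?thesis using assms
  proof (induction I rule: wf_induct_rule)
    case (less I)
    note I = less.prems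
    show ?case
    proof (cases "1 \<in> I")
      case True
      then have "I = UNIV" using ring_ideal_simps(3)[OF I(1), of 1] by auto
      \<comment> \<open>The zero ring is represented by matrices of size 0.\<close>
      then show ?thesis by (intro exI[of _ 0]) (simp add: matrix_rep_def rep_kernel_def)
    next
      case proper: False
      show ?thesis
      proof (cases "\<exists>J1 J2. ring_ideal J1 \<and> ring_ideal J2 \<and> J1 \<inter> J2 = I \<and> J1 \<noteq> I \<and> J2 \<noteq> I")
        case True
        then obtain J1 J2 where J: "ring_ideal J1" "ring_ideal J2" "J1 \<inter> J2 = I" "J1 \<noteq> I" "J2 \<noteq> I" by blast
        then have R: "(J1, I) \<in> R" "(J2, I) \<in> R" using I by (auto simp: R_def)
        obtain d f where f: "matrix_rep poly_scale (poly_scale :: 'k \<Rightarrow> _) d f" "rep_kernel d f = J1"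
          using less.IH[OF R(1) J(1)] I(2) J(3) by blast
        obtain e g where g: "matrix_rep poly_scale (poly_scale :: 'k \<Rightarrow> _) e g" "rep_kernel e g = J2"
          using less.IH[OF R(2) J(2)] I(2) J(3) by blast
        have "poly_scale c 0 = (0 :: 'k polynomial)" for c by (simp add: poly_scale_def)
        from matrix_rep_block_sum[OF f(1) g(1) this] show ?thesis unfolding f(2) g(2) J(3) .
      next
        case False
        have primary: "a \<in> I \<or> (\<exists>k. b ^ k \<in> I)" if "a * b \<in> I" for a b
        proof (rule primary_if_irreducible[OF I _ that])
          show "J1 = I \<or> J2 = I" if "ring_ideal J1" "ring_ideal J2" "J1 \<inter> J2 = I" for J1 J2
            using False that by blast
        qed
        obtain m f where f: "matrix_rep poly_scale (\<lambda>c x. to_fract (pconst c) * x) m f" "rep_kernel m f = I"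
          using primary_representation[OF I(1) proper I(2) primary] by blast
        show ?thesis using descend_to_polynomials[OF f(1), of n] I(2) unfolding f(2) by blast
      qed
    qed
  qed
qed

section \<open>Affine representable algebras\<close>

theorem proposition1:
  fixes scale_R :: "'k::field \<Rightarrow> 'r::ring_1 \<Rightarrow> 'r"
  assumes "affine_algebra scale_R"
    and "representable TYPE('c::comm_ring_1) scale_R"
  shows "\<exists>V. coefficient_algebra scale_R (poly_scale :: 'k \<Rightarrow> _) (polynomial_algebra V)"
proof -
  obtain S where S: "finite S" "subalgebra scale_R hull S = UNIV"
    using assms(1) unfolding affine_algebra_def by blast
  obtain scale_C :: "'k \<Rightarrow> 'c \<Rightarrow> 'c" and C d \<phi> where C: "k_algebra scale_C"
    and \<phi>: "mat_algebra_hom scale_R scale_C C d \<phi>" and inj: "inj \<phi>"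
    using assms(2) unfolding representable_def coefficient_algebra_def by blast
  interpret C: k_algebra scale_C by (rule C)
  define f where "f i j x = \<phi> x $$ (i, j)" for i j x
  have f: "matrix_rep scale_R scale_C d f"
    unfolding f_def by (rule matrix_rep_of_hom[OF \<phi>])
  note fs = matrix_rep_simps[OF f]
  define emb where "emb c = scale_C c 1" for c
  have emb: "comm_ring_hom emb"
    by unfold_locales (simp_all add: emb_def C.scale_left_distrib C.scale_mult_left)
  have emb_times: "emb c * x = scale_C c x" for c x by (simp add: emb_def C.scale_mult_left)
  have "finite ((\<lambda>(i, j, s). f i j s) ` ({..<d} \<times> {..<d} \<times> S))" using S(1) by simp
  then obtain n x where nx: "(\<lambda>(i, j, s). f i j s) ` ({..<d} \<times> {..<d} \<times> S) = x ` {i::nat. i < n}"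
    using finite_imp_nat_seg_image_inj_on by metis
  define \<pi> where "\<pi> = eval_polynomial emb (\<lambda>i. if i < n then x i else 0)"
  have \<pi>: "comm_ring_hom \<pi>" unfolding \<pi>_def by (rule eval_polynomial_hom[OF emb])
  interpret \<pi>: comm_ring_hom \<pi> by (rule \<pi>)
  have \<pi>_const: "\<pi> (pconst c) = emb c" for c unfolding \<pi>_def by (rule eval_polynomial_const[OF emb])
  have \<pi>_var: "\<pi> (pvar i) = (if i < n then x i else 0)" for i
    unfolding \<pi>_def by (rule eval_polynomial_var[OF emb])
  have \<pi>_scale: "\<pi> (poly_scale c p) = scale_C c (\<pi> p)" for c p
    unfolding poly_scale_def \<pi>.hom_mult \<pi>_const emb_times ..
  \<comment> \<open>Elements whose matrices only involve the algebra generated by the entries for the generators.\<close>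
  let ?T = "{r. \<forall>i<d. \<forall>j<d. f i j r \<in> range \<pi>}"
  have range_add: "y + z \<in> range \<pi>" if "y \<in> range \<pi>" "z \<in> range \<pi>" for y z
    using that by (auto simp flip: \<pi>.hom_add)
  have range_mult: "y * z \<in> range \<pi>" if "y \<in> range \<pi>" "z \<in> range \<pi>" for y z
    using that by (auto simp flip: \<pi>.hom_mult)
  have range_scale: "scale_C c y \<in> range \<pi>" if "y \<in> range \<pi>" for c y
    using that by (auto simp flip: \<pi>_scale)
  have range_0: "0 \<in> range \<pi>" by (metis \<pi>.hom_zero rangeI)
  have range_1: "1 \<in> range \<pi>" by (metis \<pi>.hom_one rangeI)
  have range_sum: "(\<Sum>k\<in>A. F k) \<in> range \<pi>" if "\<And>k. k \<in> A \<Longrightarrow> F k \<in> range \<pi>" for F and A :: "nat set"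
    using that by (induction A rule: infinite_finite_induct) (auto intro: range_add range_0)
  have "subalgebra scale_R ?T"
    unfolding subalgebra_def
    by (auto simp: fs(1-4) range_0 range_1 intro!: range_add range_scale range_sum range_mult)
  moreover have "S \<subseteq> ?T"
  proof (intro subsetI CollectI allI impI)
    fix s i j assume "s \<in> S" "i < d" "j < d"
    then have "f i j s \<in> (\<lambda>(i, j, s). f i j s) ` ({..<d} \<times> {..<d} \<times> S)" by force
    then obtain v where "f i j s = x v" "v < n" unfolding nx by blast
    then have "f i j s = \<pi> (pvar v)" by (simp add: \<pi>_var)
    then show "f i j s \<in> range \<pi>" by simp
  qed
  ultimately have "subalgebra scale_R hull S \<subseteq> ?T" by (intro hull_minimal)
  then have entries: "f i j r \<in> range \<pi>" if "i < d" "j < d" for i j r using S(2) that by blast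
  have "ring_ideal {p. \<pi> p = 0}"
    by (auto simp: ring_ideal_def \<pi>.hom_add \<pi>.hom_mult)
  moreover have "pvar v \<in> {p. \<pi> p = 0}" if "v \<ge> n" for v using that by (simp add: \<pi>_var)
  ultimately have "\<exists>e g. matrix_rep poly_scale (poly_scale :: 'k \<Rightarrow> _) e g \<and>
      rep_kernel e g = {p. \<pi> p = 0}"
    by (rule ideal_representation)
  then obtain e g where g: "matrix_rep poly_scale (poly_scale :: 'k \<Rightarrow> _) e g"
      "rep_kernel e g = {p. \<pi> p = 0}" by blast
  have "\<exists>d' F. matrix_rep scale_R (poly_scale :: 'k \<Rightarrow> _) d' F \<and> rep_kernel d' F = rep_kernel d f"
    by (rule matrix_rep_compose[OF f entries \<pi> \<pi>_scale g])
  then obtain d' F where F: "matrix_rep scale_R (poly_scale :: 'k \<Rightarrow> _) d' F"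
    "rep_kernel d' F = rep_kernel d f" by blast
  have ker: "r = 0" if r: "r \<in> rep_kernel d f" for r
  proof -
    have carrier: "\<phi> y \<in> carrier_mat d d" for y
      using \<phi> unfolding mat_algebra_hom_def by blast
    have "\<phi> r $$ (i, j) = \<phi> 0 $$ (i, j)" if "i < d" "j < d" for i j
      using r fs(5)[OF that] that by (simp add: rep_kernel_def f_def)
    then have "\<phi> r = \<phi> 0" by (intro eq_matI) (simp_all add: carrier_matD[OF carrier])
    then show ?thesis using inj by (simp add: inj_eq)
  qed
  let ?\<Phi> = "\<lambda>x. mat d' d' (\<lambda>(i, j). F i j x)"
  have "mat_algebra_hom scale_R poly_scale UNIV d' ?\<Phi>" by (rule hom_of_matrix_rep[OF F(1)])
  moreover have "inj ?\<Phi>"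
  proof (rule injI)
    fix y z assume eq: "?\<Phi> y = ?\<Phi> z"
    have "F i j (y - z) = 0" if "i < d'" "j < d'" for i j
    proof -
      have "?\<Phi> y $$ (i, j) = ?\<Phi> z $$ (i, j)" by (simp only: eq)
      then show ?thesis using that by (simp add: matrix_rep_simps(6)[OF F(1)])
    qed
    then have "y - z \<in> rep_kernel d f" unfolding F(2)[symmetric] by (simp add: rep_kernel_def)
    then have "y - z = 0" by (rule ker)
    then show "y = z" by simp
  qed
  moreover have "d' > 0"
  proof (rule ccontr)
    assume "\<not> d' > 0"
    then have "1 \<in> rep_kernel d f" unfolding F(2)[symmetric] by (simp add: rep_kernel_def)
    then have "(1 :: 'r) = 0" by (rule ker)
    then show False by simp
  qed
  ultimately have "coefficient_algebra scale_R (poly_scale :: 'k \<Rightarrow> _) (polynomial_algebra UNIV)"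
    unfolding coefficient_algebra_def polynomial_algebra_UNIV
    using k_algebra_poly_scale subalgebra_polynomial_algebra[of UNIV, unfolded polynomial_algebra_UNIV]
    by blast
  then show ?thesis by blast
qed

end
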